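(* The even Weyl group $W^+(G_2^{++})$ of the hyperbolic Kac--Moody algebra $G_2^{++}$ is an index 2 extension of $W^+(A_2^{++})$, that is, $$W^+(G_2^{++})\cong W^+(A_2^{++})\rtimes 2\cong PSL_2(\mathtt{E})\rtimes 2,$$ where $\mathtt{E}=\mathbb{Z}[e^{2\pi i/3}]$ is the ring of Eisenstein integers.
   Context: For a Kac--Moody algebra with Cartan matrix $[A_{IJ}]$, the Weyl group $W$ is the Coxeter group with generators $w_I$ and relations $w_I^2=1$, $(w_Iw_J)^{m_{IJ}}=1$ for $I\ne J$, where $m_{IJ}=2,3,4,6,\infty$ according as $A_{IJ}A_{JI}=0,1,2,3,\ge4$. $W^+\subset W$ is the index 2 subgroup of products of an even number of generators. $X^{++}$ denotes the over-extension of the finite type $X$ (the untwisted affine extension with one more node $-1$ attached by a single line to the affine node $0$). Both diagrams have nodes $-1,0,1,2$. For $A_2^{++}$: $m_{IJ}=3$ for the pairs $\{-1,0\},\{0,1\},\{0,2\},\{1,2\}$ and $m_{IJ}=2$ for the other pairs. For $G_2^{++}$: $m_{-1,0}=3$, $m_{0,1}=3$, $m_{1,2}=6$ and $m_{IJ}=2$ for the other pairs. $PSL_2(\mathtt{E})=SL_2(\mathtt{E})/\{\pm1\}$. The notation $A\rtimes 2$ means a semi-direct product of $A$ with $\mathbb{Z}/2\mathbb{Z}$: a group with a normal subgroup isomorphic to $A$ of index 2 and a complementary subgroup of order 2, acting on $A$ by conjugation as automorphisms. *)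

theory Defs
  imports "HOL-Analysis.Analysis" "HOL-Algebra.Coset"
begin

(* Group presentations: a letter (x, True) stands for the generator x,
   a letter (x, False) for its formal inverse. *)

type_synonym 'a word = "('a \<times> bool) list"

abbreviation words :: "'a set \<Rightarrow> 'a word set" where
  "words S \<equiv> lists (S \<times> UNIV)"

inductive_set presentation_rel :: "'a set \<Rightarrow> 'a word set \<Rightarrow> ('a word \<times> 'a word) set"
  for S :: "'a set" and R :: "'a word set" where
  refl: "w \<in> words S \<Longrightarrow> (w, w) \<in> presentation_rel S R"
| sym: "(v, w) \<in> presentation_rel S R \<Longrightarrow> (w, v) \<in> presentation_rel S R"
| trans: "(u, v) \<in> presentation_rel S R \<Longrightarrow> (v, w) \<in> presentation_rel S R
    \<Longrightarrow> (u, w) \<in> presentation_rel S R"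
| cancel: "x \<in> S \<Longrightarrow> u \<in> words S \<Longrightarrow> v \<in> words S
    \<Longrightarrow> (u @ [(x, b), (x, \<not> b)] @ v, u @ v) \<in> presentation_rel S R"
| relator: "r \<in> R \<Longrightarrow> r \<in> words S \<Longrightarrow> u \<in> words S \<Longrightarrow> v \<in> words S
    \<Longrightarrow> (u @ r @ v, u @ v) \<in> presentation_rel S R"

definition presented_group :: "'a set \<Rightarrow> 'a word set \<Rightarrow> 'a word set monoid" where
  "presented_group S R =
    \<lparr>carrier = words S // presentation_rel S R,
     mult = (\<lambda>X Y. \<Union>x\<in>X. \<Union>y\<in>Y. presentation_rel S R `` {x @ y}),
     one = presentation_rel S R `` {[]}\<rparr>"

definition presented_gen :: "'a set \<Rightarrow> 'a word set \<Rightarrow> 'a \<Rightarrow> 'a word set" where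
  "presented_gen S R x = presentation_rel S R `` {[(x, True)]}"

lemma presentation_rel_words:
  "(v, w) \<in> presentation_rel S R \<Longrightarrow> v \<in> words S \<and> w \<in> words S"
  by (induction rule: presentation_rel.induct) auto

lemma equiv_presentation_rel: "equiv (words S) (presentation_rel S R)"
proof (rule equivI)
  show "presentation_rel S R \<subseteq> words S \<times> words S"
    by (auto dest: presentation_rel_words simp del: in_lists_conv_set)
  show "refl_on (words S) (presentation_rel S R)"
    by (rule refl_onI) (rule presentation_rel.refl)
  show "sym (presentation_rel S R)"
    by (rule symI) (rule presentation_rel.sym)
  show "trans (presentation_rel S R)"
    by (rule transI) (rule presentation_rel.trans)
qed

lemma presentation_rel_append:
  assumes "(v, w) \<in> presentation_rel S R" and "(v', w') \<in> presentation_rel S R"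
  shows "(v @ v', w @ w') \<in> presentation_rel S R"
proof -
  have left: "(a @ v, a @ w) \<in> presentation_rel S R"
    if "(v, w) \<in> presentation_rel S R" "a \<in> words S" for a v w
    using that
  proof (induction rule: presentation_rel.induct)
    case (cancel x u v b)
    then show ?case
      using presentation_rel.cancel[of x S "a @ u" v b R] by auto
  next
    case (relator r u v)
    then show ?case
      using presentation_rel.relator[of r R S "a @ u" v] by auto
  next
    case (refl w)
    then show ?case
      by (intro presentation_rel.refl) (simp del: in_lists_conv_set)
  next
    case (sym v w)
    show ?case
      by (rule presentation_rel.sym) (rule sym.IH[OF sym.prems])
  next
    case (trans u v w)
    show ?case
      by (rule presentation_rel.trans[OF trans.IH(1)[OF trans.prems] trans.IH(2)[OF trans.prems]])
  qed
  have right: "(v @ a, w @ a) \<in> presentation_rel S R"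
    if "(v, w) \<in> presentation_rel S R" "a \<in> words S" for a v w
    using that
  proof (induction rule: presentation_rel.induct)
    case (cancel x u v b)
    then show ?case
      using presentation_rel.cancel[of x S u "v @ a" b R] by auto
  next
    case (relator r u v)
    then show ?case
      using presentation_rel.relator[of r R S u "v @ a"] by auto
  next
    case (refl w)
    then show ?case
      by (intro presentation_rel.refl) (simp del: in_lists_conv_set)
  next
    case (sym v w)
    show ?case
      by (rule presentation_rel.sym) (rule sym.IH[OF sym.prems])
  next
    case (trans u v w)
    show ?case
      by (rule presentation_rel.trans[OF trans.IH(1)[OF trans.prems] trans.IH(2)[OF trans.prems]])
  qed
  have "(v @ v', w @ v') \<in> presentation_rel S R"
    using right assms presentation_rel_words by blast
  moreover have "(w @ v', w @ w') \<in> presentation_rel S R"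
    using left assms presentation_rel_words by blast
  ultimately show ?thesis
    by (rule presentation_rel.trans)
qed

lemma presented_group_mult_class:
  assumes "v \<in> words S" "w \<in> words S"
  shows "presentation_rel S R `` {v} \<otimes>\<^bsub>presented_group S R\<^esub> presentation_rel S R `` {w}
    = presentation_rel S R `` {v @ w}"
proof -
  have "congruent2 (presentation_rel S R) (presentation_rel S R)
      (\<lambda>x y. presentation_rel S R `` {x @ y})"
    by (intro congruent2I' equiv_class_eq[OF equiv_presentation_rel] presentation_rel_append)
  then show ?thesis
    using UN_equiv_class2[OF equiv_presentation_rel equiv_presentation_rel _ assms]
    by (simp add: presented_group_def)
qed

lemma group_presented_group: "group (presented_group S R)"
proof (rule groupI)
  have carrier: "carrier (presented_group S R) = words S // presentation_rel S R"
    and one: "\<one>\<^bsub>presented_group S R\<^esub> = presentation_rel S R `` {[]}"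
    by (simp_all add: presented_group_def)
  note class_defs = carrier one
  show "\<one>\<^bsub>presented_group S R\<^esub> \<in> carrier (presented_group S R)"
    unfolding class_defs by (rule quotientI) simp
  fix X assume "X \<in> carrier (presented_group S R)"
  then obtain x where x: "x \<in> words S" "X = presentation_rel S R `` {x}"
    unfolding class_defs by (rule quotientE)
  show "\<one>\<^bsub>presented_group S R\<^esub> \<otimes>\<^bsub>presented_group S R\<^esub> X = X"
    unfolding class_defs x(2) by (subst presented_group_mult_class) (use x in auto)
  have inv: "\<exists>y\<in>words S. (y @ x, []) \<in> presentation_rel S R"
    using x(1)
  proof (induction x rule: list.induct)
    case Nil
    then show ?case by (intro bexI[of _ "[]"]) (auto intro: presentation_rel.refl)
  next
    case (Cons p x)
    then obtain y where y: "y \<in> words S" "(y @ x, []) \<in> presentation_rel S R"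
      by auto
    obtain g b where p: "p = (g, b)" by (cases p)
    have "(y @ [(g, \<not> b), (g, \<not> \<not> b)] @ x, y @ x) \<in> presentation_rel S R"
      using Cons.prems y(1) p by (intro presentation_rel.cancel) auto
    then have "((y @ [(g, \<not> b)]) @ p # x, []) \<in> presentation_rel S R"
      using presentation_rel.trans[OF _ y(2)] p by simp
    moreover have "y @ [(g, \<not> b)] \<in> words S"
      using y(1) Cons.prems p by auto
    ultimately show ?case by blast
  qed
  then obtain y where y: "y \<in> words S" "(y @ x, []) \<in> presentation_rel S R"
    by blast
  show "\<exists>Y\<in>carrier (presented_group S R).
      Y \<otimes>\<^bsub>presented_group S R\<^esub> X = \<one>\<^bsub>presented_group S R\<^esub>"
  proof
    show "presentation_rel S R `` {y} \<otimes>\<^bsub>presented_group S R\<^esub> X = \<one>\<^bsub>presented_group S R\<^esub>"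
      unfolding x(2) presented_group_mult_class[OF y(1) x(1)] one
      using y(2) by (rule equiv_class_eq[OF equiv_presentation_rel])
    show "presentation_rel S R `` {y} \<in> carrier (presented_group S R)"
      unfolding carrier using y(1) by (rule quotientI)
  qed
  fix Y assume "Y \<in> carrier (presented_group S R)"
  then obtain y where y: "y \<in> words S" "Y = presentation_rel S R `` {y}"
    unfolding class_defs by (rule quotientE)
  show "X \<otimes>\<^bsub>presented_group S R\<^esub> Y \<in> carrier (presented_group S R)"
    unfolding x(2) y(2) presented_group_mult_class[OF x(1) y(1)] carrier
    by (rule quotientI) (use x(1) y(1) in auto)
  fix Z assume "Z \<in> carrier (presented_group S R)"
  then obtain z where z: "z \<in> words S" "Z = presentation_rel S R `` {z}"
    unfolding class_defs by (rule quotientE)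
  have xy: "x @ y \<in> words S" and yz: "y @ z \<in> words S"
    using x(1) y(1) z(1) by auto
  show "X \<otimes>\<^bsub>presented_group S R\<^esub> Y \<otimes>\<^bsub>presented_group S R\<^esub> Z =
      X \<otimes>\<^bsub>presented_group S R\<^esub> (Y \<otimes>\<^bsub>presented_group S R\<^esub> Z)"
    unfolding x(2) y(2) z(2) presented_group_mult_class[OF x(1) y(1)]
      presented_group_mult_class[OF y(1) z(1)] presented_group_mult_class[OF xy z(1)]
      presented_group_mult_class[OF x(1) yz]
    by simp
qed


definition coxeter_exponent :: "('i \<Rightarrow> 'i \<Rightarrow> int) \<Rightarrow> 'i \<Rightarrow> 'i \<Rightarrow> enat" where
  "coxeter_exponent A i j =
    (let p = A i j * A j i
     in if p = 0 then 2 else if p = 1 then 3 else if p = 2 then 4 else if p = 3 then 6 else \<infinity>)"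

definition weyl_relators :: "'i set \<Rightarrow> ('i \<Rightarrow> 'i \<Rightarrow> int) \<Rightarrow> 'i word set" where
  "weyl_relators I A =
    {[(i, True), (i, True)] | i. i \<in> I} \<union>
    {concat (replicate m [(i, True), (j, True)]) | i j m.
       i \<in> I \<and> j \<in> I \<and> i \<noteq> j \<and> coxeter_exponent A i j = enat m}"

definition weyl_group :: "'i set \<Rightarrow> ('i \<Rightarrow> 'i \<Rightarrow> int) \<Rightarrow> 'i word set monoid" where
  "weyl_group I A = presented_group I (weyl_relators I A)"

definition weyl_gen :: "'i set \<Rightarrow> ('i \<Rightarrow> 'i \<Rightarrow> int) \<Rightarrow> 'i \<Rightarrow> 'i word set" where
  "weyl_gen I A i = presented_gen I (weyl_relators I A) i"

definition even_weyl_group :: "'i set \<Rightarrow> ('i \<Rightarrow> 'i \<Rightarrow> int) \<Rightarrow> 'i word set monoid" where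
  "even_weyl_group I A = (weyl_group I A)
    \<lparr>carrier := {foldr (\<otimes>\<^bsub>weyl_group I A\<^esub>) (map (weyl_gen I A) is) \<one>\<^bsub>weyl_group I A\<^esub>
                 | is. is \<in> lists I \<and> even (length is)}\<rparr>"


definition nodes :: "int set" where
  "nodes = {-1, 0, 1, 2}"

definition cartan_A2pp :: "int \<Rightarrow> int \<Rightarrow> int" where
  "cartan_A2pp i j =
    (if i = j then 2
     else if {i, j} \<in> {{-1, 0}, {0, 1}, {0, 2}, {1, 2}} then -1
     else 0)"

(* Node 1 is the long and node 2 the short simple root of G2, and
   the (i, j) entry is 2 (a_i, a_j) / (a_i, a_i). *)
definition cartan_G2pp :: "int \<Rightarrow> int \<Rightarrow> int" where
  "cartan_G2pp i j =
    (if i = j then 2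
     else if (i, j) = (2, 1) then -3
     else if {i, j} \<in> {{-1, 0}, {0, 1}, {1, 2}} then -1
     else 0)"

lemma coxeter_exponent_A2pp:
  assumes "i \<in> nodes" "j \<in> nodes" "i \<noteq> j"
  shows "coxeter_exponent cartan_A2pp i j =
    (if {i, j} \<in> {{-1, 0}, {0, 1}, {0, 2}, {1, 2}} then 3 else 2)"
  using assms unfolding nodes_def
  by (elim insertE emptyE; hypsubst;
      simp add: coxeter_exponent_def cartan_A2pp_def doubleton_eq_iff)

lemma coxeter_exponent_G2pp:
  assumes "i \<in> nodes" "j \<in> nodes" "i \<noteq> j"
  shows "coxeter_exponent cartan_G2pp i j =
    (if {i, j} \<in> {{-1, 0}, {0, 1}} then 3 else if {i, j} = {1, 2} then 6 else 2)"
  using assms unfolding nodes_def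
  by (elim insertE emptyE; hypsubst;
      simp add: coxeter_exponent_def cartan_G2pp_def doubleton_eq_iff)

abbreviation even_weyl_A2pp :: "int word set monoid" where
  "even_weyl_A2pp \<equiv> even_weyl_group nodes cartan_A2pp"

abbreviation even_weyl_G2pp :: "int word set monoid" where
  "even_weyl_G2pp \<equiv> even_weyl_group nodes cartan_G2pp"


definition eisenstein_integers :: "complex set" where
  "eisenstein_integers =
    {of_int a + of_int b * exp (2 * of_real pi * \<i> / 3) | a b. True}"

definition SL2_E :: "(complex ^ 2 ^ 2) monoid" where
  "SL2_E =
    \<lparr>carrier = {M. det M = 1 \<and> (\<forall>i j. M $ i $ j \<in> eisenstein_integers)},
     mult = (**),
     one = mat 1\<rparr>"

definition PSL2_E :: "(complex ^ 2 ^ 2) set monoid" where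
  "PSL2_E = SL2_E Mod {mat 1, - mat 1}"


definition is_semidirect_by_2 :: "('a, 'c) monoid_scheme \<Rightarrow> ('b, 'd) monoid_scheme \<Rightarrow> bool" where
  "is_semidirect_by_2 G A \<longleftrightarrow>
    (\<exists>N K. N \<lhd> G \<and> G\<lparr>carrier := N\<rparr> \<cong> A \<and> card (rcosets\<^bsub>G\<^esub> N) = 2 \<and>
           subgroup K G \<and> card K = 2 \<and>
           N \<inter> K = {\<one>\<^bsub>G\<^esub>} \<and> N <#>\<^bsub>G\<^esub> K = carrier G)"

end

theory Submission
  imports Defs
begin

text \<open>
The Weyl group \<open>W(A\<^sub>2\<^sup>+\<^sup>+)\<close> is realised as a reflection group of hyperbolic 3-space. A complex matrix \<open>M\<close>
acts on two by two matrices by \<open>X \<mapsto> M X M\<^sup>*\<close>, and the simple reflections are given by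
\<open>X \<mapsto> M\<^sub>i cnj(X) M\<^sub>i\<^sup>*\<close> with matrices \<open>M\<^sub>i\<close> over the Eisenstein integers of determinant \<open>- 1\<close>. On
Hermitian normal vectors of the walls they satisfy the usual formulas for simple reflections and simple
roots. Since all the orders \<open>m\<^sub>i\<^sub>j\<close> of \<open>A\<^sub>2\<^sup>+\<^sup>+\<close> are 2 or 3, Tits' argument that the action is faithful takes a short form
(\<open>simply_laced_action_faithful\<close>).

A product of two reflections acts as \<open>X \<mapsto> M X M\<^sup>*\<close> with \<open>M = M\<^sub>i cnj(M\<^sub>j)\<close> in \<open>SL\<^sub>2(E)\<close>. As the Eisenstein
integers are Euclidean, \<open>SL\<^sub>2(E)\<close> is generated by diagonal matrices, the inversion and translations,
all of which come from such pairs (\<open>even_image\<close>). So the even subgroup and \<open>PSL\<^sub>2(E)\<close> have the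
same image among the transformations, and both map to it injectively.

In \<open>W(G\<^sub>2\<^sup>+\<^sup>+)\<close>, with generators \<open>t i\<close>, the long root reflections \<open>t (- 1)\<close>, \<open>t 0\<close>, \<open>t 1\<close>,
\<open>t 2 \<otimes> t 1 \<otimes> t 2\<close> satisfy the relations of \<open>A\<^sub>2\<^sup>+\<^sup>+\<close>. If \<open>t 2\<close> acts as entrywise conjugation, they act
exactly as the simple reflections of \<open>A\<^sub>2\<^sup>+\<^sup>+\<close>, whence \<open>W(A\<^sub>2\<^sup>+\<^sup>+)\<close> embeds (\<open>A2pp_into_G2pp\<close>). Conjugation
by \<open>t 2\<close> exchanges the last two of them, so \<open>W(G\<^sub>2\<^sup>+\<^sup>+)\<close> is the product of this subgroup
and \<open>\<langle>t 2\<rangle>\<close>; restricted to even elements, the even part of the subgroup is the kernel of the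
character that sends \<open>t 2\<close> to \<open>- 1\<close> and the other generators to 1, and the involution
\<open>t (- 1) \<otimes> t 2\<close> generates a complement.
\<close>

section \<open>Presented groups and Weyl groups\<close>

definition gprod :: "('a, 'b) monoid_scheme \<Rightarrow> 'a list \<Rightarrow> 'a" where
  "gprod G xs = foldr (\<otimes>\<^bsub>G\<^esub>) xs \<one>\<^bsub>G\<^esub>"

lemma gprod_Nil [simp]: "gprod G [] = \<one>\<^bsub>G\<^esub>"
  and gprod_Cons [simp]: "gprod G (x # xs) = x \<otimes>\<^bsub>G\<^esub> gprod G xs"
  by (simp_all add: gprod_def)

context group
begin

lemma gprod_closed [simp]: "set xs \<subseteq> carrier G \<Longrightarrow> gprod G xs \<in> carrier G"
  by (induction xs) auto

lemma gprod_append: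
  "set xs \<subseteq> carrier G \<Longrightarrow> set ys \<subseteq> carrier G \<Longrightarrow> gprod G (xs @ ys) = gprod G xs \<otimes> gprod G ys"
  by (induction xs) (auto simp: m_assoc)

lemma gprod_replicate:
  assumes "set xs \<subseteq> carrier G"
  shows "gprod G (concat (replicate m xs)) = gprod G xs [^] m"
proof (induction m)
  case (Suc m)
  have "set (concat (replicate m xs)) \<subseteq> carrier G"
    using assms by (auto split: if_splits)
  then have "gprod G (concat (replicate (Suc m) xs)) = gprod G xs \<otimes> gprod G xs [^] m"
    using assms Suc by (simp add: gprod_append)
  also have "\<dots> = gprod G xs [^] Suc m"
    using assms by (intro nat_pow_Suc2[symmetric] gprod_closed)
  finally show ?case .
qed simp

lemma inv_gprod_involutions:
  assumes "set xs \<subseteq> carrier G" "\<And>x. x \<in> set xs \<Longrightarrow> x \<otimes> x = \<one>"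
  shows "inv (gprod G xs) = gprod G (rev xs)"
  using assms
proof (induction xs)
  case (Cons x xs)
  then have "inv x = x"
    by (simp add: inv_equality)
  with Cons show ?case
    by (simp add: inv_mult_group gprod_append)
qed simp

end

lemma (in group_hom) hom_gprod:
  "set xs \<subseteq> carrier G \<Longrightarrow> h (gprod G xs) = gprod H (map h xs)"
  by (induction xs) auto

definition letter_val :: "('g, 'c) monoid_scheme \<Rightarrow> ('a \<Rightarrow> 'g) \<Rightarrow> 'a \<times> bool \<Rightarrow> 'g" where
  "letter_val H f l = (if snd l then f (fst l) else inv\<^bsub>H\<^esub> f (fst l))"

lemma presented_group_class:
  assumes "X \<in> carrier (presented_group S R)"
  obtains w where "w \<in> words S" "X = presentation_rel S R `` {w}"
  using assms unfolding presented_group_def by simp (erule quotientE, blast)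

text \<open>
Von Dyck's theorem. Every homomorphism out of a Weyl group used below comes from it: evaluating
words in \<open>H\<close> respects the defining relation, hence descends to the classes.
\<close>

lemma presented_group_universal:
  assumes H: "group H" and f: "\<And>x. x \<in> S \<Longrightarrow> f x \<in> carrier H"
    and R: "\<And>r. r \<in> R \<Longrightarrow> r \<in> words S \<Longrightarrow> gprod H (map (letter_val H f) r) = \<one>\<^bsub>H\<^esub>"
  obtains F where "F \<in> hom (presented_group S R) H" "\<And>x. x \<in> S \<Longrightarrow> F (presented_gen S R x) = f x"
proof -
  interpret H: group H by (rule H)
  define E where "E = (\<lambda>w. gprod H (map (letter_val H f) w))"
  have lv: "set (map (letter_val H f) w) \<subseteq> carrier H" if "w \<in> words S" for w
    using that by (auto simp: letter_val_def f)
  have E_append: "E (v @ w) = E v \<otimes>\<^bsub>H\<^esub> E w" if "v \<in> words S" "w \<in> words S" for v w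
    using H.gprod_append[OF lv lv] that by (simp add: E_def)
  have E_closed: "E w \<in> carrier H" if "w \<in> words S" for w
    unfolding E_def by (rule H.gprod_closed[OF lv[OF that]])
  have E_resp: "E v = E w" if "(v, w) \<in> presentation_rel S R" for v w
    using that
  proof (induction rule: presentation_rel.induct)
    case (cancel x u v b)
    have "E [(x, b), (x, \<not> b)] = \<one>\<^bsub>H\<^esub>"
      using f[OF cancel(1)] by (cases b) (auto simp: E_def letter_val_def)
    moreover have "[(x, b), (x, \<not> b)] \<in> words S" 
      using cancel by auto
    moreover have "[(x, b), (x, \<not> b)] @ v \<in> words S" 
      using cancel by auto
    ultimately show ?case
      using cancel by (simp only: E_append E_closed H.l_one)
  next
    case (relator r u v)
    have "E r = \<one>\<^bsub>H\<^esub>"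
      using R relator by (simp add: E_def)
    moreover have "r @ v \<in> words S" 
      using relator by auto
    ultimately show ?case
      using relator by (simp only: E_append E_closed H.l_one)
  qed auto
  define F where "F X = the_elem (E ` X)" for X
  have F: "F (presentation_rel S R `` {w}) = E w" if "w \<in> words S" for w
  proof -
    have "E ` (presentation_rel S R `` {w}) = {E w}"
      using E_resp presentation_rel.refl[OF that] by force
    then show ?thesis by (simp add: F_def)
  qed
  show thesis
  proof
    show "F \<in> hom (presented_group S R) H"
    proof (rule homI)
      fix X assume "X \<in> carrier (presented_group S R)"
      then obtain x where x: "x \<in> words S" "X = presentation_rel S R `` {x}"
        by (rule presented_group_class)
      show "F X \<in> carrier H"
        unfolding x(2) F[OF x(1)] by (rule E_closed[OF x(1)])
      fix Y assume "Y \<in> carrier (presented_group S R)"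
      then obtain y where y: "y \<in> words S" "Y = presentation_rel S R `` {y}"
        by (rule presented_group_class)
      have xy: "x @ y \<in> words S"
        using x(1) y(1) by auto
      show "F (X \<otimes>\<^bsub>presented_group S R\<^esub> Y) = F X \<otimes>\<^bsub>H\<^esub> F Y"
        unfolding x(2) y(2) presented_group_mult_class[OF x(1) y(1)]
          F[OF x(1)] F[OF y(1)] F[OF xy] by (rule E_append[OF x(1) y(1)])
    qed
    show "F (presented_gen S R x) = f x" if "x \<in> S" for x
    proof -
      have "[(x, True)] \<in> words S" using that by auto
      then show ?thesis
        unfolding presented_gen_def using F[of "[(x, True)]"] f[OF that] 
        by (simp add: E_def letter_val_def)
    qed
  qed
qed

lemma presented_gen_closed: "x \<in> S \<Longrightarrow> presented_gen S R x \<in> carrier (presented_group S R)"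
  unfolding presented_gen_def presented_group_def by (auto intro!: quotientI)

lemma gprod_presented_gen:
  assumes "xs \<in> lists S"
  shows "gprod (presented_group S R) (map (presented_gen S R) xs)
    = presentation_rel S R `` {map (\<lambda>x. (x, True)) xs}"
  using assms
proof (induction xs)
  case Nil
  then show ?case by (simp add: presented_group_def)
next
  case (Cons x xs)
  have *: "[(x, True)] \<in> words S" "map (\<lambda>x. (x, True)) xs \<in> words S"
    using Cons.hyps by auto
  show ?case
    using presented_group_mult_class[OF *, of R] Cons.IH
    by (simp add: presented_gen_def)
qed

lemma presented_group_relator:
  assumes "map (\<lambda>x. (x, True)) xs \<in> R" "xs \<in> lists S"
  shows "gprod (presented_group S R) (map (presented_gen S R) xs) = \<one>\<^bsub>presented_group S R\<^esub>"
proof -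
  have "([] @ map (\<lambda>x. (x, True)) xs @ [], [] @ []) \<in> presentation_rel S R"
    using assms by (intro presentation_rel.relator) auto
  then show ?thesis
    unfolding gprod_presented_gen[OF assms(2)]
    by (simp add: presented_group_def equiv_class_eq[OF equiv_presentation_rel])
qed

lemma group_weyl_group: "group (weyl_group I A)"
  unfolding weyl_group_def by (rule group_presented_group)

lemma weyl_gen_closed: "i \<in> I \<Longrightarrow> weyl_gen I A i \<in> carrier (weyl_group I A)"
  by (simp add: weyl_gen_def weyl_group_def presented_gen_closed)

lemma weyl_gens_closed: "is \<in> lists I \<Longrightarrow> set (map (weyl_gen I A) is) \<subseteq> carrier (weyl_group I A)"
  by (auto simp: weyl_gen_closed)

lemma weyl_gen_square:
  assumes "i \<in> I"
  shows "weyl_gen I A i \<otimes>\<^bsub>weyl_group I A\<^esub> weyl_gen I A i = \<one>\<^bsub>weyl_group I A\<^esub>"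
proof -
  interpret W: group "weyl_group I A" by (rule group_weyl_group)
  have "gprod (weyl_group I A) (map (weyl_gen I A) [i, i]) = \<one>\<^bsub>weyl_group I A\<^esub>"
    unfolding weyl_group_def weyl_gen_def
    by (rule presented_group_relator) (use assms in \<open>auto simp: weyl_relators_def\<close>)
  then show ?thesis
    using weyl_gen_closed[OF assms, of A] by simp
qed

lemma weyl_gen_braid:
  assumes "i \<in> I" "j \<in> I" "i \<noteq> j" "coxeter_exponent A i j = enat m"
  shows "(weyl_gen I A i \<otimes>\<^bsub>weyl_group I A\<^esub> weyl_gen I A j) [^]\<^bsub>weyl_group I A\<^esub> m = \<one>\<^bsub>weyl_group I A\<^esub>"
proof -
  interpret W: group "weyl_group I A" by (rule group_weyl_group)
  have "gprod (weyl_group I A) (map (weyl_gen I A) (concat (replicate m [i, j]))) = \<one>\<^bsub>weyl_group I A\<^esub>"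
    unfolding weyl_group_def weyl_gen_def
    by (rule presented_group_relator) (use assms in \<open>auto simp: weyl_relators_def map_concat split: if_splits\<close>)
  then show ?thesis
    using weyl_gen_closed[OF assms(1), of A] weyl_gen_closed[OF assms(2), of A]
    by (simp add: map_concat W.gprod_replicate)
qed

lemma weyl_group_universal:
  assumes H: "group H" and h: "\<And>i. i \<in> I \<Longrightarrow> h i \<in> carrier H"
    and square: "\<And>i. i \<in> I \<Longrightarrow> h i \<otimes>\<^bsub>H\<^esub> h i = \<one>\<^bsub>H\<^esub>"
    and braid: "\<And>i j m. \<lbrakk>i \<in> I; j \<in> I; i \<noteq> j; coxeter_exponent A i j = enat m\<rbrakk>
      \<Longrightarrow> (h i \<otimes>\<^bsub>H\<^esub> h j) [^]\<^bsub>H\<^esub> m = \<one>\<^bsub>H\<^esub>"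
  obtains F where "F \<in> hom (weyl_group I A) H" "\<And>i. i \<in> I \<Longrightarrow> F (weyl_gen I A i) = h i"
proof -
  interpret H: group H by (rule H)
  have "gprod H (map (letter_val H h) r) = \<one>\<^bsub>H\<^esub>" if "r \<in> weyl_relators I A" for r
    using that unfolding weyl_relators_def
    by (auto simp: letter_val_def h square map_concat H.gprod_replicate braid)
  then obtain F where "F \<in> hom (presented_group I (weyl_relators I A)) H"
      "\<And>i. i \<in> I \<Longrightarrow> F (presented_gen I (weyl_relators I A) i) = h i"
    using presented_group_universal[where S = I and R = "weyl_relators I A" and f = h, OF H h] by blast
  then show thesis
    by (intro that) (simp_all add: weyl_group_def weyl_gen_def)
qed

text \<open>
The generators are involutions, so a formal inverse letter has the same class as the letter itself
and words without inverse letters suffice.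
\<close>

lemma weyl_group_generated:
  assumes "x \<in> carrier (weyl_group I A)"
  obtains "is" where "is \<in> lists I" "x = gprod (weyl_group I A) (map (weyl_gen I A) is)"
proof -
  let ?r = "presentation_rel I (weyl_relators I A)" and ?W = "weyl_group I A"
  interpret W: group ?W by (rule group_weyl_group)
  obtain w where w: "w \<in> words I" "x = ?r `` {w}"
    using assms unfolding weyl_group_def by (rule presented_group_class)
  have letter: "?r `` {[(i, b)]} = weyl_gen I A i" if "i \<in> I" for i b
  proof (cases b)
    case False
    have ws: "[(i, True)] \<in> words I" "[(i, False)] \<in> words I" using that by auto
    have "([] @ [(i, False), (i, \<not> False)] @ [], [] @ []) \<in> ?r"
      using that by (intro presentation_rel.cancel) auto
    then have "?r `` {[(i, False)]} \<otimes>\<^bsub>?W\<^esub> weyl_gen I A i = \<one>\<^bsub>?W\<^esub>"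
      unfolding weyl_gen_def weyl_group_def presented_gen_def presented_group_mult_class[OF ws(2,1)]
      by (simp add: presented_group_def equiv_class_eq[OF equiv_presentation_rel])
    moreover have "?r `` {[(i, False)]} \<in> carrier ?W"
      using ws(2) by (simp only: weyl_group_def presented_group_def) (auto intro: quotientI)
    ultimately have "?r `` {[(i, False)]} = inv\<^bsub>?W\<^esub> weyl_gen I A i"
      by (simp add: W.inv_equality that weyl_gen_closed)
    also have "\<dots> = weyl_gen I A i"
      by (simp add: W.inv_equality that weyl_gen_closed weyl_gen_square)
    finally show ?thesis using False by simp
  qed (simp add: weyl_gen_def presented_gen_def)
  have "?r `` {w} = gprod ?W (map (weyl_gen I A) (map fst w))"
    using w(1)
  proof (induction w rule: lists.induct)
    case Nil
    then show ?case by (simp add: weyl_group_def presented_group_def)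
  next
    case (Cons l w)
    obtain i b where l: "l = (i, b)" "i \<in> I" using Cons.hyps by auto
    have ws: "[l] \<in> words I" "w \<in> words I" using Cons.hyps l by auto
    have "?r `` {l # w} = ?r `` {[l]} \<otimes>\<^bsub>?W\<^esub> ?r `` {w}"
      using presented_group_mult_class[OF ws, of "weyl_relators I A"] by (simp add: weyl_group_def)
    then show ?case
      using Cons.IH l letter by simp
  qed
  moreover have "map fst w \<in> lists I"
    using w(1) by fastforce
  ultimately show thesis using that w(2) by blast
qed

lemma even_weyl_group_eq:
  "even_weyl_group I A = (weyl_group I A)\<lparr>carrier :=
    {gprod (weyl_group I A) (map (weyl_gen I A) is) | is. is \<in> lists I \<and> even (length is)}\<rparr>"
  by (simp add: even_weyl_group_def gprod_def)

lemma carrier_even_weyl_group: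
  "carrier (even_weyl_group I A) =
    {gprod (weyl_group I A) (map (weyl_gen I A) is) | is. is \<in> lists I \<and> even (length is)}"
  by (simp add: even_weyl_group_eq)

lemma subgroup_even_weyl: "subgroup (carrier (even_weyl_group I A)) (weyl_group I A)"
proof -
  let ?W = "weyl_group I A" and ?g = "weyl_gen I A"
  interpret W: group ?W by (rule group_weyl_group)
  note closed = weyl_gens_closed[of _ I A]
  show ?thesis unfolding carrier_even_weyl_group
  proof (rule W.subgroupI)
    show "{gprod ?W (map ?g is) |is. is \<in> lists I \<and> even (length is)} \<subseteq> carrier ?W"
      using W.gprod_closed[OF closed] by blast
    show "{gprod ?W (map ?g is) |is. is \<in> lists I \<and> even (length is)} \<noteq> {}"
      by (simp del: in_lists_conv_set) (intro exI[of _ "[]"], simp)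
  next
    fix a assume "a \<in> {gprod ?W (map ?g is) |is. is \<in> lists I \<and> even (length is)}"
    then obtain "is" where a: "a = gprod ?W (map ?g is)" "is \<in> lists I" "even (length is)" by blast
    have "inv\<^bsub>?W\<^esub> a = gprod ?W (map ?g (rev is))"
      unfolding a(1) rev_map[symmetric]
      by (rule W.inv_gprod_involutions[OF closed[OF a(2)]]) (use a(2) in \<open>auto simp: weyl_gen_square\<close>)
    moreover have "rev is \<in> lists I" "even (length (rev is))" using a by auto
    ultimately show "inv\<^bsub>?W\<^esub> a \<in> {gprod ?W (map ?g is) |is. is \<in> lists I \<and> even (length is)}"
      by blast
    fix b assume "b \<in> {gprod ?W (map ?g is) |is. is \<in> lists I \<and> even (length is)}"
    then obtain js where b: "b = gprod ?W (map ?g js)" "js \<in> lists I" "even (length js)" by blast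
    have "a \<otimes>\<^bsub>?W\<^esub> b = gprod ?W (map ?g (is @ js))"
      using W.gprod_append[OF closed[OF a(2)] closed[OF b(2)]] by (simp add: a(1) b(1))
    moreover have "is @ js \<in> lists I" "even (length (is @ js))" using a b by auto
    ultimately show "a \<otimes>\<^bsub>?W\<^esub> b \<in> {gprod ?W (map ?g is) |is. is \<in> lists I \<and> even (length is)}"
      by blast
  qed
qed

section \<open>Faithful actions of simply laced Coxeter groups\<close>

text \<open>
Tits' faithfulness argument for simply laced Coxeter groups, in which every rank two parabolic
subgroup has order 4 or 6. Instead of positive roots as nonnegative combinations of simple ones,
it is enough to have an additive functional \<open>f\<close> that is positive on the simple
roots \<open>\<alpha> i\<close>. The claim is that \<open>f (act x (\<alpha> s)) > 0\<close> whenever right multiplication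
by \<open>g s\<close> does not shorten \<open>x\<close>. If \<open>x \<noteq> \<one>\<close>, some \<open>g s\<close> shortens \<open>x\<close>, and the claim for
\<open>x \<otimes> g s\<close> shows that \<open>x\<close> sends \<open>\<alpha> s\<close> to an element on which \<open>f\<close> is negative.
\<close>

lemma (in group) simply_laced_action_faithful:
  fixes act :: "'a \<Rightarrow> 'v::ab_group_add \<Rightarrow> 'v" and f :: "'v \<Rightarrow> real"
  assumes g: "\<And>i. i \<in> I \<Longrightarrow> g i \<in> carrier G"
    and square: "\<And>i. i \<in> I \<Longrightarrow> g i \<otimes> g i = \<one>"
    and generated: "\<And>x. x \<in> carrier G \<Longrightarrow> \<exists>w \<in> lists I. x = gprod G (map g w)"
    and laced: "\<And>i j. \<lbrakk>i \<in> I; j \<in> I; i \<noteq> j\<rbrakk> \<Longrightarrow>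
        g i \<otimes> g j = g j \<otimes> g i \<and> act (g i) (\<alpha> j) = \<alpha> j \<or>
        g i \<otimes> (g j \<otimes> g i) = g j \<otimes> (g i \<otimes> g j) \<and> act (g i) (\<alpha> j) = \<alpha> i + \<alpha> j
          \<and> act (g j) (\<alpha> i) = \<alpha> i + \<alpha> j"
    and act_mult: "\<And>x y v. \<lbrakk>x \<in> carrier G; y \<in> carrier G\<rbrakk> \<Longrightarrow> act (x \<otimes> y) v = act x (act y v)"
    and act_one: "\<And>v. act \<one> v = v"
    and act_add: "\<And>x u v. x \<in> carrier G \<Longrightarrow> act x (u + v) = act x u + act x v"
    and act_root: "\<And>i. i \<in> I \<Longrightarrow> act (g i) (\<alpha> i) = - \<alpha> i"
    and f_add: "\<And>u v. f (u + v) = f u + f v"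
    and f_root: "\<And>i. i \<in> I \<Longrightarrow> f (\<alpha> i) > 0"
    and x: "x \<in> carrier G" "\<And>v. act x v = v"
  shows "x = \<one>"
proof -
  define l where "l x = (LEAST n. \<exists>w \<in> lists I. length w = n \<and> x = gprod G (map g w))" for x
  have l_word: "\<exists>w \<in> lists I. length w = l x \<and> x = gprod G (map g w)" if "x \<in> carrier G" for x
    unfolding l_def by (rule LeastI_ex) (use generated[OF that] in blast)
  have l_le: "l (gprod G (map g w)) \<le> length w" if "w \<in> lists I" for w
    unfolding l_def by (rule Least_le) (use that in blast)
  have gs: "set (map g w) \<subseteq> carrier G" if "w \<in> lists I" for w
    using that g by auto
  have l_Suc: "l (x \<otimes> g i) \<le> Suc (l x)" if "x \<in> carrier G" "i \<in> I" for x i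
  proof -
    obtain w where w: "w \<in> lists I" "length w = l x" "x = gprod G (map g w)"
      using l_word \<open>x \<in> carrier G\<close> by blast
    have "x \<otimes> g i = gprod G (map g (w @ [i]))"
      using gprod_append[OF gs[OF w(1)], of "[g i]"] g[OF \<open>i \<in> I\<close>] w(3) by simp
    then show ?thesis
      using l_le[of "w @ [i]"] w \<open>i \<in> I\<close> by simp
  qed
  have cancel: "x \<otimes> g i \<otimes> g i = x" if "x \<in> carrier G" "i \<in> I" for x i
    using that by (simp add: m_assoc g square)
  have descent: "\<exists>i\<in>I. l (x \<otimes> g i) < l x" if x: "x \<in> carrier G" "x \<noteq> \<one>" for x
  proof -
    obtain w where w: "w \<in> lists I" "length w = l x" "x = gprod G (map g w)"
      using l_word x by blast
    with x(2) have "w \<noteq> []" by auto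
    then obtain js i where js: "w = js @ [i]" by (cases w rule: rev_cases) auto
    then have ji: "js \<in> lists I" "i \<in> I" using w(1) by auto
    have "x = gprod G (map g js) \<otimes> g i"
      using gprod_append[OF gs[OF ji(1)], of "[g i]"] g[OF \<open>i \<in> I\<close>] w(3) js by simp
    then have "x \<otimes> g i = gprod G (map g js)"
      using cancel[OF gprod_closed[OF gs[OF ji(1)]] ji(2)] by simp
    then show ?thesis
      using l_le[OF ji(1)] w(2) js ji(2) by (intro bexI[of _ i]) auto
  qed
  \<comment> \<open>Induction on the length, comparing \<open>x\<close> with its minimal coset representative modulo \<open>\<langle>g s, g t\<rangle>\<close>.\<close>
  have positive: "f (act x (\<alpha> s)) > 0"
    if "x \<in> carrier G" "s \<in> I" "l x \<le> l (x \<otimes> g s)" for x s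
    using that
  proof (induction "l x" arbitrary: x s rule: less_induct)
    case less
    note x = less.prems(1) and s = less.prems(2) and up = less.prems(3)
    show ?case
    proof (cases "x = \<one>")
      case True
      then show ?thesis by (simp add: act_one f_root s)
    next
      case False
      then obtain t where t: "t \<in> I" "l (x \<otimes> g t) < l x"
        using descent x by blast
      have "t \<noteq> s" using t(2) up by auto
      define v where "v = x \<otimes> g t"
      have v: "v \<in> carrier G" "l v < l x" "x = v \<otimes> g t"
        using t x g cancel by (simp_all add: v_def)
      have vt: "l v \<le> l (v \<otimes> g t)" using v by simp
      have act_x: "act x (\<alpha> s) = act v (act (g t) (\<alpha> s))"
        unfolding v(3) by (rule act_mult) (use v t g in auto)
      consider (commute) "g t \<otimes> g s = g s \<otimes> g t" "act (g t) (\<alpha> s) = \<alpha> s"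
        | (braid) "g t \<otimes> (g s \<otimes> g t) = g s \<otimes> (g t \<otimes> g s)" "act (g t) (\<alpha> s) = \<alpha> t + \<alpha> s"
            "act (g s) (\<alpha> t) = \<alpha> t + \<alpha> s"
        using laced[OF t(1) s \<open>t \<noteq> s\<close>] by blast
      then show ?thesis
      proof cases
        case commute
        have "x \<otimes> g s = v \<otimes> g s \<otimes> g t"
          using v t s g commute(1) by (simp add: m_assoc)
        then have "l (x \<otimes> g s) \<le> Suc (l (v \<otimes> g s))"
          using l_Suc[of "v \<otimes> g s" t] v t s g by simp
        then have "l v \<le> l (v \<otimes> g s)"
          using up v(2) by linarith
        then show ?thesis
          unfolding act_x commute(2) using less.hyps[OF v(2,1) s] by simp
      next
        case braid
        have pos_t: "f (act v (\<alpha> t)) > 0"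
          by (rule less.hyps[OF v(2,1) t(1) vt])
        have split: "f (act x (\<alpha> s)) = f (act v (\<alpha> t)) + f (act v (\<alpha> s))"
          unfolding act_x braid(2) by (simp add: act_add v f_add)
        show ?thesis
        proof (cases "l v \<le> l (v \<otimes> g s)")
          case True
          then show ?thesis
            using less.hyps[OF v(2,1) s True] pos_t split by simp
        next
          case False
          \<comment> \<open>Now \<open>x = u \<otimes> g s \<otimes> g t\<close>, and the braid relation keeps \<open>g t\<close> from shortening \<open>u\<close>.\<close>
          define u where "u = v \<otimes> g s"
          have u: "u \<in> carrier G" "l u < l v" "v = u \<otimes> g s"
            using False v s g cancel by (simp_all add: u_def)
          have "x \<otimes> g s = u \<otimes> (g s \<otimes> (g t \<otimes> g s))"
            unfolding v(3) u(3) using u(1) s t g by (simp add: m_assoc)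
          also have "\<dots> = u \<otimes> g t \<otimes> g s \<otimes> g t"
            unfolding braid(1)[symmetric] using u(1) s t g by (simp add: m_assoc)
          finally have "l (x \<otimes> g s) \<le> Suc (Suc (l (u \<otimes> g t)))"
            using l_Suc[of "u \<otimes> g t \<otimes> g s" t] l_Suc[of "u \<otimes> g t" s] u(1) t s g by simp
          then have ut: "l u \<le> l (u \<otimes> g t)"
            using up v(2) u(2) by linarith
          have "act v (\<alpha> t) + act v (\<alpha> s) = act u (act (g s) (\<alpha> t + \<alpha> s))"
            unfolding u(3) using act_mult[OF u(1) g[OF s]] by (simp add: act_add u(1) g s)
          also have "act (g s) (\<alpha> t + \<alpha> s) = \<alpha> t"
            by (simp add: act_add g s act_root braid(3))
          finally have "f (act x (\<alpha> s)) = f (act u (\<alpha> t))"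
            unfolding split f_add[symmetric] by simp
          then show ?thesis
            using less.hyps[OF _ u(1) t(1) ut] u(2) v(2) by simp
        qed
      qed
    qed
  qed
  show ?thesis
  proof (rule ccontr)
    assume "x \<noteq> \<one>"
    then obtain s where s: "s \<in> I" "l (x \<otimes> g s) < l x"
      using descent x(1) by blast
    have xs: "x \<otimes> g s \<in> carrier G" using x(1) g s by simp
    have "act (x \<otimes> g s) (\<alpha> s) = - \<alpha> s"
      using act_mult[OF x(1) g[OF s(1)]] by (simp add: act_root s x(2))
    moreover have "f (act (x \<otimes> g s) (\<alpha> s)) > 0"
      using positive[OF xs s(1)] cancel[OF x(1) s(1)] s(2) by simp
    moreover have "f (- \<alpha> s) = - f (\<alpha> s)"
      using f_add[of "\<alpha> s" "- \<alpha> s"] f_add[of 0 0] by simp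
    ultimately show False
      using f_root[OF s(1)] by simp
  qed
qed

section \<open>Eisenstein integers\<close>

definition omega :: complex ("\<omega>") where "\<omega> = exp (2 * of_real pi * \<i> / 3)"

lemma omega_eq: "\<omega> = Complex (-1/2) (sqrt 3 / 2)"
proof -
  have "\<omega> = cis (2 * pi / 3)"
    by (simp add: omega_def cis_conv_exp mult_ac)
  then show ?thesis
    by (simp add: complex_eq_iff cos_120 sin_120)
qed

lemma omega_mult [simp]: "\<omega> * \<omega> = - 1 - \<omega>" "\<omega> * (\<omega> * z) = (- 1 - \<omega>) * z"
proof -
  show 1: "\<omega> * \<omega> = - 1 - \<omega>"
    by (simp add: omega_eq complex_eq_iff)
  show "\<omega> * (\<omega> * z) = (- 1 - \<omega>) * z"
    by (simp add: 1 flip: mult.assoc)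
qed

lemma cnj_omega [simp]: "cnj \<omega> = - 1 - \<omega>"
  by (simp add: omega_eq complex_eq_iff)

abbreviation E :: "complex set" where "E \<equiv> eisenstein_integers"

lemma E_iff: "z \<in> E \<longleftrightarrow> (\<exists>a b. z = of_int a + of_int b * \<omega>)"
  by (auto simp: eisenstein_integers_def omega_def)

lemma E_of_int [simp]: "of_int a \<in> E"
  unfolding E_iff by (rule exI[of _ a], rule exI[of _ 0]) simp

lemma E_0 [simp]: "0 \<in> E" and E_1 [simp]: "1 \<in> E"
  using E_of_int[of 0] E_of_int[of 1] by simp_all

lemma E_omega [simp]: "\<omega> \<in> E"
  unfolding E_iff by (rule exI[of _ 0], rule exI[of _ 1]) simp

lemma E_add [simp]: "x \<in> E \<Longrightarrow> y \<in> E \<Longrightarrow> x + y \<in> E"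
  unfolding E_iff
proof (elim exE)
  fix a b c d :: int
  assume "x = of_int a + of_int b * \<omega>" "y = of_int c + of_int d * \<omega>"
  then show "\<exists>a b. x + y = of_int a + of_int b * \<omega>"
    by (intro exI[of _ "a + c"] exI[of _ "b + d"]) (simp add: algebra_simps)
qed

lemma E_uminus [simp]: "x \<in> E \<Longrightarrow> - x \<in> E"
  unfolding E_iff
proof (elim exE)
  fix a b :: int
  assume "x = of_int a + of_int b * \<omega>"
  then show "\<exists>a b. - x = of_int a + of_int b * \<omega>"
    by (intro exI[of _ "- a"] exI[of _ "- b"]) (simp add: algebra_simps)
qed

lemma E_diff [simp]: "x \<in> E \<Longrightarrow> y \<in> E \<Longrightarrow> x - y \<in> E"
  using E_add[of x "- y"] by simp

lemma E_mult [simp]: "x \<in> E \<Longrightarrow> y \<in> E \<Longrightarrow> x * y \<in> E"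
  unfolding E_iff
proof (elim exE)
  fix a b c d :: int
  assume "x = of_int a + of_int b * \<omega>" "y = of_int c + of_int d * \<omega>"
  then show "\<exists>a b. x * y = of_int a + of_int b * \<omega>"
    by (intro exI[of _ "a * c - b * d"] exI[of _ "a * d + b * c - b * d"]) (simp add: algebra_simps)
qed

lemma E_cnj [simp]: "x \<in> E \<Longrightarrow> cnj x \<in> E"
  unfolding E_iff[of x] by auto

text \<open>
The norm form of the Eisenstein integers, for real coordinates as it also measures remainders.
\<close>

lemma norm_E: "(cmod (of_real a + of_real b * \<omega>))\<^sup>2 = a\<^sup>2 - a * b + b\<^sup>2"
proof -
  have "(cmod (of_real a + of_real b * \<omega>))\<^sup>2 = (a - b / 2)\<^sup>2 + (b * (sqrt 3 / 2))\<^sup>2"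
    by (simp add: cmod_power2 omega_eq)
  also have "\<dots> = a\<^sup>2 - a * b + b\<^sup>2"
    by (simp add: power_mult_distrib power_divide power2_diff field_simps)
  finally show ?thesis .
qed

lemma norm_E_int:
  assumes "z \<in> E" obtains n :: nat where "(cmod z)\<^sup>2 = real n"
proof -
  obtain a b where "z = of_int a + of_int b * \<omega>"
    using assms by (auto simp: E_iff)
  then have *: "(cmod z)\<^sup>2 = of_int (a\<^sup>2 - a * b + b\<^sup>2)"
    using norm_E[of "of_int a" "of_int b"] by simp
  then have "0 \<le> a\<^sup>2 - a * b + b\<^sup>2"
    by (metis of_int_0_le_iff zero_le_power2)
  then show thesis
    using * by (intro that[of "nat (a\<^sup>2 - a * b + b\<^sup>2)"]) simp
qed

text \<open>
The Eisenstein integers are norm-Euclidean: rounding both coordinates leaves \<open>\<bar>u\<bar>, \<bar>v\<bar> \<le> 1/2\<close>,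
and then the norm form is at most \<open>3/4\<close>.
\<close>

lemma E_nearest: "\<exists>q\<in>E. cmod (z - q) < 1"
proof -
  define y where "y = 2 * Im z / sqrt 3"
  define x where "x = Re z + y / 2"
  have z: "z = of_real x + of_real y * \<omega>"
    by (simp add: x_def y_def omega_eq complex_eq_iff)
  define u v where "u = x - of_int (round x)" and "v = y - of_int (round y)"
  have u: "\<bar>u\<bar> \<le> 1/2" "\<bar>v\<bar> \<le> 1/2"
    using of_int_round_abs_le[of x] of_int_round_abs_le[of y] by (simp_all add: u_def v_def abs_minus_commute)
  have uv: "u\<^sup>2 \<le> 1/4" "v\<^sup>2 \<le> 1/4" "\<bar>u * v\<bar> \<le> 1/4"
    using power_mono[OF u(1), of 2] power_mono[OF u(2), of 2] mult_mono[OF u]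
    by (simp_all add: abs_mult power2_eq_square)
  define q :: complex where "q = of_int (round x) + of_int (round y) * \<omega>"
  have zq: "z - q = of_real u + of_real v * \<omega>"
    by (simp add: z q_def u_def v_def algebra_simps)
  have "(cmod (z - q))\<^sup>2 = u\<^sup>2 - u * v + v\<^sup>2"
    unfolding zq by (rule norm_E)
  also have "\<dots> < 1\<^sup>2"
    using uv by (auto simp: abs_if split: if_splits)
  finally have "cmod (z - q) < 1"
    by (rule power_less_imp_less_base) simp
  moreover have "q \<in> E" unfolding E_iff q_def by blast
  ultimately show ?thesis by blast
qed

text \<open>
A unit has norm 1, which bounds both coordinates by 1 and leaves only the six powers of \<open>- \<omega>\<close>.
\<close>

lemma E_unit:
  assumes "a \<in> E" "d \<in> E" "a * d = 1"
  shows "a \<in> {1, -1, \<omega>, -\<omega>, \<omega> + 1, - 1 - \<omega>}"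
proof -
  obtain n where n: "(cmod a)\<^sup>2 = real n" using norm_E_int assms by blast
  obtain k where k: "(cmod d)\<^sup>2 = real k" using norm_E_int assms by blast
  have "(cmod a)\<^sup>2 * (cmod d)\<^sup>2 = 1"
    using assms(3) by (metis norm_mult norm_one power_mult_distrib one_power2)
  then have "n * k = 1"
    unfolding n k by (metis of_nat_mult of_nat_eq_1_iff)
  then have "n = 1" by simp
  obtain x y where a: "a = of_int x + of_int y * \<omega>"
    using assms by (auto simp: E_iff)
  have "of_int (x\<^sup>2 - x * y + y\<^sup>2) = (1::real)"
    using n \<open>n = 1\<close> norm_E[of "of_int x" "of_int y"] a by simp
  then have xy: "x\<^sup>2 - x * y + y\<^sup>2 = 1" by linarith
  have "3 * x\<^sup>2 + (x - 2 * y)\<^sup>2 = 4"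
    using xy by (simp add: power2_eq_square algebra_simps)
  then have x: "3 * x\<^sup>2 \<le> 4" using zero_le_power2[of "x - 2 * y"] by linarith
  have "3 * y\<^sup>2 + (y - 2 * x)\<^sup>2 = 4"
    using xy by (simp add: power2_eq_square algebra_simps)
  then have y: "3 * y\<^sup>2 \<le> 4" using zero_le_power2[of "y - 2 * x"] by linarith
  have small: "z \<in> {-1, 0, 1}" if "3 * z\<^sup>2 \<le> 4" for z :: int
  proof -
    have "\<bar>z\<bar> < 2"
    proof (rule ccontr)
      assume "\<not> \<bar>z\<bar> < 2"
      then have "2\<^sup>2 \<le> \<bar>z\<bar>\<^sup>2" by (intro power_mono) auto
      with that show False by simp
    qed
    then show ?thesis by auto
  qed
  from small[OF x] small[OF y] xy a show ?thesis
    by auto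
qed

section \<open>Hermitian actions of two by two complex matrices\<close>

definition mat2 :: "complex \<Rightarrow> complex \<Rightarrow> complex \<Rightarrow> complex \<Rightarrow> complex ^ 2 ^ 2" where
  "mat2 a b c d = vector [vector [a, b], vector [c, d]]"

lemma mat2_nth [simp]:
  "mat2 a b c d $ 1 $ 1 = a" "mat2 a b c d $ 1 $ 2 = b"
  "mat2 a b c d $ 2 $ 1 = c" "mat2 a b c d $ 2 $ 2 = d"
  by (simp_all add: mat2_def)

lemma mat2_exhaust: obtains a b c d where "M = mat2 a b c d"
proof
  show "M = mat2 (M $ 1 $ 1) (M $ 1 $ 2) (M $ 2 $ 1) (M $ 2 $ 2)"
    by (simp add: vec_eq_iff forall_2)
qed

lemma mat2_eq_iff [simp]:
  "mat2 a b c d = mat2 a' b' c' d' \<longleftrightarrow> a = a' \<and> b = b' \<and> c = c' \<and> d = d'"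
  by (auto simp: vec_eq_iff forall_2)

lemma mat2_mult [simp]:
  "mat2 a b c d ** mat2 a' b' c' d' =
    mat2 (a * a' + b * c') (a * b' + b * d') (c * a' + d * c') (c * b' + d * d')"
  by (simp add: vec_eq_iff forall_2 matrix_matrix_mult_def sum_2)

lemma det_mat2 [simp]: "det (mat2 a b c d) = a * d - b * c"
  by (simp add: det_2)

lemma mat2_add [simp]: "mat2 a b c d + mat2 a' b' c' d' = mat2 (a + a') (b + b') (c + c') (d + d')"
  and mat2_uminus [simp]: "- mat2 a b c d = mat2 (- a) (- b) (- c) (- d)"
  and mat_1: "mat 1 = mat2 1 0 0 1"
  by (simp_all add: vec_eq_iff forall_2 mat_def)

definition cnj_mat :: "complex ^ 2 ^ 2 \<Rightarrow> complex ^ 2 ^ 2" where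
  "cnj_mat M = (\<chi> i j. cnj (M $ i $ j))"

definition ctranspose :: "complex ^ 2 ^ 2 \<Rightarrow> complex ^ 2 ^ 2" where
  "ctranspose M = (\<chi> i j. cnj (M $ j $ i))"

lemma cnj_mat_mat2 [simp]: "cnj_mat (mat2 a b c d) = mat2 (cnj a) (cnj b) (cnj c) (cnj d)"
  and ctranspose_mat2 [simp]: "ctranspose (mat2 a b c d) = mat2 (cnj a) (cnj c) (cnj b) (cnj d)"
  by (simp_all add: cnj_mat_def ctranspose_def vec_eq_iff forall_2)

lemma cnj_mat_mult: "cnj_mat (M ** N) = cnj_mat M ** cnj_mat N"
  by (cases M rule: mat2_exhaust; cases N rule: mat2_exhaust) simp

lemma ctranspose_mult: "ctranspose (M ** N) = ctranspose N ** ctranspose M"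
  by (cases M rule: mat2_exhaust; cases N rule: mat2_exhaust) (simp add: mult_ac)

lemma cnj_mat_ctranspose: "cnj_mat (ctranspose M) = ctranspose (cnj_mat M)"
  by (cases M rule: mat2_exhaust) simp

lemma cnj_mat_cnj_mat [simp]: "cnj_mat (cnj_mat M) = M"
  by (cases M rule: mat2_exhaust) simp

lemma cnj_mat_add: "cnj_mat (M + N) = cnj_mat M + cnj_mat N"
  by (cases M rule: mat2_exhaust; cases N rule: mat2_exhaust) simp

lemma det_cnj_mat: "det (cnj_mat M) = cnj (det M)"
  by (cases M rule: mat2_exhaust) simp

definition herm :: "complex ^ 2 ^ 2 \<Rightarrow> complex ^ 2 ^ 2 \<Rightarrow> complex ^ 2 ^ 2" where
  "herm M X = M ** X ** ctranspose M"

lemma herm_mult: "herm (M ** N) = herm M \<circ> herm N"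
  by (simp add: fun_eq_iff herm_def ctranspose_mult matrix_mul_assoc)

lemma herm_mat_1 [simp]: "herm (mat 1) = id"
proof -
  have "ctranspose (mat 1) = mat 1" by (simp add: mat_1)
  then show ?thesis by (simp add: fun_eq_iff herm_def)
qed

lemma herm_uminus [simp]: "herm (- M) = herm M"
proof
  fix X show "herm (- M) X = herm M X"
    by (cases M rule: mat2_exhaust; cases X rule: mat2_exhaust) (simp add: herm_def algebra_simps)
qed

lemma cnj_mat_herm: "cnj_mat \<circ> herm M = herm (cnj_mat M) \<circ> cnj_mat"
  by (simp add: fun_eq_iff herm_def cnj_mat_mult cnj_mat_ctranspose)

lemma herm_add: "herm M (X + Y) = herm M X + herm M Y"
  by (cases M rule: mat2_exhaust; cases X rule: mat2_exhaust; cases Y rule: mat2_exhaust)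
    (simp add: herm_def algebra_simps)

text \<open>
The three matrix units \<open>E\<^sub>1\<^sub>1\<close>, \<open>E\<^sub>1\<^sub>2\<close>, \<open>E\<^sub>2\<^sub>2\<close> force \<open>M\<close> to be a scalar; the determinant then leaves a sign.
\<close>

lemma herm_eq_id:
  assumes "herm M = id" "det M = 1"
  shows "M = mat 1 \<or> M = - mat 1"
proof -
  obtain a b c d where M: "M = mat2 a b c d" by (rule mat2_exhaust)
  have e1: "herm M (mat2 1 0 0 0) = mat2 1 0 0 0" and e2: "herm M (mat2 0 1 0 0) = mat2 0 1 0 0"
    and e4: "herm M (mat2 0 0 0 1) = mat2 0 0 0 1"
    using assms(1) by simp_all
  have "b = 0" "c = 0"
    using e1 e4 by (simp_all add: M herm_def)
  have "a * cnj a = 1" "a * cnj d = 1"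
    using e1 e2 by (simp_all add: M herm_def)
  then have "cnj a = cnj d" by (metis mult_left_cancel mult_zero_left zero_neq_one)
  then have "a = d" by simp
  with assms(2) \<open>b = 0\<close> have "a * a = 1" by (simp add: M)
  then have "a = 1 \<or> a = - 1" by (simp add: square_eq_1_iff)
  with \<open>b = 0\<close> \<open>c = 0\<close> \<open>a = d\<close> show ?thesis
    by (auto simp: M mat_1)
qed

lemma carrier_SL2_E: "carrier SL2_E = {mat2 a b c d | a b c d. a \<in> E \<and> b \<in> E \<and> c \<in> E \<and> d \<in> E \<and> a * d - b * c = 1}"
proof (rule Set.set_eqI)
  fix M obtain a b c d where M: "M = mat2 a b c d" by (rule mat2_exhaust)
  show "M \<in> carrier SL2_E \<longleftrightarrow> M \<in> {mat2 a b c d | a b c d. a \<in> E \<and> b \<in> E \<and> c \<in> E \<and> d \<in> E \<and> a * d - b * c = 1}"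
    unfolding M by (auto simp: SL2_E_def forall_2)
qed

lemma carrier_SL2_E_entries: "carrier SL2_E = {M. det M = 1 \<and> (\<forall>i j. M $ i $ j \<in> E)}"
  by (simp add: SL2_E_def)

lemma mult_SL2_E [simp]: "x \<otimes>\<^bsub>SL2_E\<^esub> y = x ** y" and one_SL2_E [simp]: "\<one>\<^bsub>SL2_E\<^esub> = mat 1"
  by (simp_all add: SL2_E_def)

lemma group_SL2_E: "group SL2_E"
proof (rule groupI)
  fix x y z :: "complex ^ 2 ^ 2"
  show "\<one>\<^bsub>SL2_E\<^esub> \<in> carrier SL2_E"
    by (simp add: carrier_SL2_E) (metis mat_1 E_0 E_1 diff_zero mult_zero_left mult_1)
  show "x \<otimes>\<^bsub>SL2_E\<^esub> y \<otimes>\<^bsub>SL2_E\<^esub> z = x \<otimes>\<^bsub>SL2_E\<^esub> (y \<otimes>\<^bsub>SL2_E\<^esub> z)"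
    by (simp add: matrix_mul_assoc)
  show "\<one>\<^bsub>SL2_E\<^esub> \<otimes>\<^bsub>SL2_E\<^esub> x = x" by simp
  assume x: "x \<in> carrier SL2_E"
  then obtain a b c d where abcd: "x = mat2 a b c d" "a \<in> E" "b \<in> E" "c \<in> E" "d \<in> E" "a * d - b * c = 1"
    by (auto simp: carrier_SL2_E)
  then have "mat2 d (- b) (- c) a \<otimes>\<^bsub>SL2_E\<^esub> x = \<one>\<^bsub>SL2_E\<^esub>"
    by (simp add: mat_1 algebra_simps)
  moreover have "mat2 d (- b) (- c) a \<in> carrier SL2_E"
    using abcd by (simp add: carrier_SL2_E mult.commute)
  ultimately show "\<exists>y\<in>carrier SL2_E. y \<otimes>\<^bsub>SL2_E\<^esub> x = \<one>\<^bsub>SL2_E\<^esub>" by blast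
  assume "y \<in> carrier SL2_E"
  with x show "x \<otimes>\<^bsub>SL2_E\<^esub> y \<in> carrier SL2_E"
    by (auto simp: carrier_SL2_E_entries det_mul) (simp add: matrix_matrix_mult_def sum_2)
qed

text \<open>
Euclid's algorithm on the first column. The induction is on the norm of the lower left entry \<open>c\<close>;
the base case \<open>c = 0\<close> is an upper triangular matrix with unit diagonal. Closure under inverses is
obtained from the finite orders of the diagonal matrix and of the inversion.
\<close>

lemma SL2_E_generators:
  assumes mult: "\<And>M N. M \<in> \<Delta> \<Longrightarrow> N \<in> \<Delta> \<Longrightarrow> M ** N \<in> \<Delta>"
    and D: "mat2 \<omega> 0 0 (- 1 - \<omega>) \<in> \<Delta>"
    and S: "mat2 0 (- 1) 1 0 \<in> \<Delta>"
    and T: "\<And>q. q \<in> E \<Longrightarrow> mat2 1 q 0 1 \<in> \<Delta>"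
    and M: "M \<in> carrier SL2_E"
  shows "M \<in> \<Delta>"
proof -
  have S2: "mat2 (- 1) 0 0 (- 1) \<in> \<Delta>" using mult[OF S S] by simp
  have S3: "mat2 0 1 (- 1) 0 \<in> \<Delta>" using mult[OF S S2] by simp
  have D2: "mat2 (- 1 - \<omega>) 0 0 \<omega> \<in> \<Delta>" using mult[OF D D] by (simp add: algebra_simps)
  have neg: "mat2 (- a) 0 0 (- d) \<in> \<Delta>" if "mat2 a 0 0 d \<in> \<Delta>" for a d
    using mult[OF S2 that] by simp
  have units: "mat2 a 0 0 d \<in> \<Delta>" if "a \<in> E" "d \<in> E" "a * d = 1" for a d
  proof -
    have a: "a \<in> {1, -1, \<omega>, -\<omega>, \<omega> + 1, - 1 - \<omega>}" by (rule E_unit[OF that])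
    have d: "d = inverse a" using that(3) by (simp add: inverse_unique)
    have "inverse \<omega> = - 1 - \<omega>" by (rule inverse_unique) (simp add: algebra_simps)
    moreover have "inverse (\<omega> + 1) = - \<omega>" by (rule inverse_unique) (simp add: algebra_simps)
    moreover have "inverse (- 1 - \<omega>) = \<omega>" by (rule inverse_unique) (simp add: algebra_simps)
    ultimately show ?thesis
      using a T[OF E_0] S2 D D2 neg[OF D] neg[OF D2] unfolding d
      by (elim insertE emptyE) simp_all
  qed
  have "mat2 a b c d \<in> \<Delta>"
    if "a \<in> E" "b \<in> E" "c \<in> E" "d \<in> E" "a * d - b * c = 1" for a b c d
    using that
  proof (induction "nat \<lfloor>(cmod c)\<^sup>2\<rfloor>" arbitrary: a b c d rule: less_induct)
    case less
    show ?case
    proof (cases "c = 0")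
      case True
      with less.prems have ad: "a * d = 1" by simp
      have "a * (b * d) = b" using ad by (metis mult.left_commute mult.right_neutral)
      then show ?thesis
        using mult[OF units[OF less.prems(1,4) ad] T[of "b * d"]] less.prems(2,4) True by (simp add: \<open>a * (b * d) = b\<close>)
    next
      case False
      obtain q where q: "q \<in> E" "cmod (a / c - q) < 1" using E_nearest by blast
      have "a - q * c = (a / c - q) * c"
        using False by (simp add: left_diff_distrib)
      then have "cmod (a - q * c) = cmod (a / c - q) * cmod c"
        by (simp only: norm_mult)
      also have "\<dots> < cmod c" using q(2) False by simp
      finally have "(cmod (a - q * c))\<^sup>2 < (cmod c)\<^sup>2" by (intro power_strict_mono) auto
      moreover obtain m where "(cmod (a - q * c))\<^sup>2 = real m"
        using norm_E_int[of "a - q * c"] less.prems q by auto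
      moreover obtain n where "(cmod c)\<^sup>2 = real n" using norm_E_int less.prems by blast
      ultimately have "nat \<lfloor>(cmod (a - q * c))\<^sup>2\<rfloor> < nat \<lfloor>(cmod c)\<^sup>2\<rfloor>" by simp
      then have "mat2 (- c) (- d) (a - q * c) (b - q * d) \<in> \<Delta>"
        by (rule less.hyps) (use less.prems q in \<open>simp_all add: algebra_simps\<close>)
      \<comment> \<open>Undo the translation by \<open>- q\<close> and the inversion that exchanged the rows.\<close>
      from mult[OF T[OF q(1)] mult[OF S3 this]]
      show ?thesis by (simp add: algebra_simps)
    qed
  qed
  with M show ?thesis by (auto simp: carrier_SL2_E)
qed

section \<open>Representations by anti-Moebius transformations\<close>

text \<open>
The target of the reflection representations. A reflection \<open>X \<mapsto> M cnj(X) M\<^sup>*\<close> is only antilinear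
over the complex numbers, so additivity is what all the maps in question share.
\<close>

definition add_aut :: "('v::ab_group_add \<Rightarrow> 'v) monoid" where
  "add_aut = \<lparr>carrier = {F. bij F \<and> (\<forall>u v. F (u + v) = F u + F v)}, mult = (\<circ>), one = id\<rparr>"

lemma mult_add_aut [simp]: "F \<otimes>\<^bsub>add_aut\<^esub> F' = F \<circ> F'"
  and one_add_aut [simp]: "\<one>\<^bsub>add_aut\<^esub> = id"
  by (simp_all add: add_aut_def)

lemma add_autI: "\<lbrakk>F \<circ> F' = id; F' \<circ> F = id; \<And>u v. F (u + v) = F u + F v\<rbrakk> \<Longrightarrow> F \<in> carrier add_aut"
  by (simp add: add_aut_def o_bij)

lemma add_aut_add: "F \<in> carrier add_aut \<Longrightarrow> F (u + v) = F u + F v"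
  by (simp add: add_aut_def)

lemma group_add_aut: "group (add_aut :: ('v::ab_group_add \<Rightarrow> 'v) monoid)"
proof (rule groupI)
  fix F :: "'v \<Rightarrow> 'v" assume F: "F \<in> carrier add_aut"
  then have "bij F" by (simp add: add_aut_def)
  then obtain F' where F': "F' \<circ> F = id" "F \<circ> F' = id"
    using bij_betw_inv_into[of F UNIV UNIV] that[of "inv_into UNIV F"]
    by (simp add: fun_eq_iff bij_is_inj bij_is_surj surj_f_inv_f)
  have "F' (u + v) = F' u + F' v" for u v
  proof -
    have "F (F' u + F' v) = u + v"
      unfolding add_aut_add[OF F] using F'(2) by (simp add: fun_eq_iff)
    then show ?thesis
      using F'(1) by (metis comp_apply id_apply)
  qed
  then have "F' \<in> carrier add_aut"
    by (rule add_autI[OF F'])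
  then show "\<exists>F'\<in>carrier add_aut. F' \<otimes>\<^bsub>add_aut\<^esub> F = \<one>\<^bsub>add_aut\<^esub>"
    using F' by auto
qed (auto simp: add_aut_def bij_comp)

lemma herm_in_add_aut: 
  assumes "M ** N = mat 1" "N ** M = mat 1" 
  shows "herm M \<in> carrier add_aut"
  by (rule add_autI[of _ "herm N"]) (simp_all add: assms herm_add flip: herm_mult)

text \<open>
On rank one matrices \<open>v v\<^sup>*\<close> with \<open>v = (z, 1)\<close> this is the anti-Moebius map
\<open>z \<mapsto> M \<cdot> cnj z\<close>, hence for suitable \<open>M\<close> a reflection of hyperbolic 3-space.
\<close>

definition anti_herm :: "complex ^ 2 ^ 2 \<Rightarrow> complex ^ 2 ^ 2 \<Rightarrow> complex ^ 2 ^ 2" where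
  "anti_herm M = herm M \<circ> cnj_mat"

lemma cnj_mat_involution: "cnj_mat \<circ> cnj_mat = id"
  by (simp add: fun_eq_iff)

lemma anti_herm_comp: "anti_herm M \<circ> anti_herm N = herm (M ** cnj_mat N)"
proof -
  have "anti_herm M \<circ> anti_herm N = herm M \<circ> (cnj_mat \<circ> herm N) \<circ> cnj_mat"
    by (simp add: anti_herm_def comp_assoc)
  also have "\<dots> = herm (M ** cnj_mat N) \<circ> (cnj_mat \<circ> cnj_mat)"
    by (simp add: cnj_mat_herm herm_mult comp_assoc)
  finally show ?thesis by (simp add: cnj_mat_involution)
qed

lemma herm_eq_idI: "M = mat 1 \<or> M = - mat 1 \<Longrightarrow> herm M = id"
  by auto

lemma anti_herm_in_add_aut: "M ** cnj_mat M = mat 1 \<or> M ** cnj_mat M = - mat 1 \<Longrightarrow> anti_herm M \<in> carrier add_aut"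
  by (rule add_autI[of _ "anti_herm M"])
    (simp_all add: anti_herm_comp herm_eq_idI, simp add: anti_herm_def cnj_mat_add herm_add)

lemma herm_pow: "herm N [^]\<^bsub>add_aut\<^esub> (m::nat) = herm (((**) N ^^ m) (mat 1))"
proof (induction m)
  case 0
  then show ?case by simp
next
  case (Suc m)
  have "((**) N ^^ m) (mat 1) ** N = N ** ((**) N ^^ m) (mat 1)"
    by (induction m) (simp_all flip: matrix_mul_assoc)
  then have "herm N \<circ> herm (((**) N ^^ m) (mat 1)) = herm (((**) N ^^ m) (mat 1)) \<circ> herm N"
    by (simp flip: herm_mult)
  with Suc show ?case by (simp add: herm_mult)
qed

lemma weyl_group_anti_herm_action:
  assumes square: "\<And>i. i \<in> I \<Longrightarrow> M i ** cnj_mat (M i) \<in> {mat 1, - mat 1}"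
    and braid: "\<And>i j m. \<lbrakk>i \<in> I; j \<in> I; i \<noteq> j; coxeter_exponent A i j = enat m\<rbrakk>
      \<Longrightarrow> ((**) (M i ** cnj_mat (M j)) ^^ m) (mat 1) \<in> {mat 1, - mat 1}"
  obtains F where "F \<in> hom (weyl_group I A) add_aut" "\<And>i. i \<in> I \<Longrightarrow> F (weyl_gen I A i) = anti_herm (M i)"
proof (rule weyl_group_universal[of add_aut I "\<lambda>i. anti_herm (M i)" A])
  show "anti_herm (M i) \<in> carrier add_aut" if "i \<in> I" for i
    using square[OF that] by (intro anti_herm_in_add_aut) auto
  show "anti_herm (M i) \<otimes>\<^bsub>add_aut\<^esub> anti_herm (M i) = \<one>\<^bsub>add_aut\<^esub>" if "i \<in> I" for i
    using square[OF that] by (auto simp: anti_herm_comp)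
  show "(anti_herm (M i) \<otimes>\<^bsub>add_aut\<^esub> anti_herm (M j)) [^]\<^bsub>add_aut\<^esub> m = \<one>\<^bsub>add_aut\<^esub>"
    if "i \<in> I" "j \<in> I" "i \<noteq> j" "coxeter_exponent A i j = enat m" for i j m
    using braid[OF that] by (auto simp: anti_herm_comp herm_pow)
qed (use group_add_aut that in auto)

text \<open>
The walls of a hyperbolic simplex: the unit sphere, and the vertical planes over the line
\<open>Re z = 1/2\<close> and over the lines through the origin at angles \<open>\<plusminus> \<pi>/6\<close>. As anti-Moebius maps the
reflections are \<open>1 / cnj z\<close>, \<open>1 - cnj z\<close> and \<open>- \<omega>\<^sup>2 cnj z\<close>, \<open>- \<omega> cnj z\<close>. The matrices are scaled by units
so that all determinants are \<open>- 1\<close>, which puts products of two of them into \<open>SL\<^sub>2\<close>;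
note \<open>\<omega>\<^sup>2 = - 1 - \<omega>\<close>.
\<close>

definition refl_mat :: "int \<Rightarrow> complex ^ 2 ^ 2" where
  "refl_mat i =
    (if i = - 1 then mat2 0 1 1 0
     else if i = 0 then mat2 (- 1) 1 0 1
     else if i = 1 then mat2 (- \<omega>) 0 0 (- 1 - \<omega>)
     else mat2 (1 + \<omega>) 0 0 \<omega>)"

text \<open>
Hermitian normal vectors of the walls, for the quadratic form \<open>- det\<close> of signature (3,1). The signs are
such that reflecting a root in the wall of a neighbouring node adds the root of that node.
\<close>

definition root :: "int \<Rightarrow> complex ^ 2 ^ 2" where
  "root i =
    (if i = - 1 then mat2 1 0 0 (- 1)
     else if i = 0 then mat2 (- 1) (- 1) (- 1) 0
     else if i = 1 then mat2 0 (- \<omega>) (1 + \<omega>) 0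
     else mat2 0 (1 + \<omega>) (- \<omega>) 0)"

text \<open>
A real linear functional chosen to be positive on all simple roots, as Tits' argument requires.
\<close>

definition height :: "complex ^ 2 ^ 2 \<Rightarrow> real" where
  "height X = 2 * Re (X $ 1 $ 2) - 3 * Re (X $ 1 $ 1) - 4 * Re (X $ 2 $ 2)"

lemma refl_mat_square: "i \<in> nodes \<Longrightarrow> refl_mat i ** cnj_mat (refl_mat i) \<in> {mat 1, - mat 1}"
  unfolding nodes_def
  by (elim insertE emptyE; hypsubst; simp add: refl_mat_def mat_1 algebra_simps)

lemma enat_eq_numeral: "numeral k = enat m \<longleftrightarrow> m = numeral k"
  by (metis enat.inject numeral_eq_enat)

lemma coxeter_exponent_A2pp_enat:
  assumes "i \<in> nodes" "j \<in> nodes" "i \<noteq> j" "coxeter_exponent cartan_A2pp i j = enat m"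
  shows "m = (if {i, j} \<in> {{-1, 0}, {0, 1}, {0, 2}, {1, 2}} then 3 else 2)"
  using assms(4) unfolding coxeter_exponent_A2pp[OF assms(1-3)]
  by (simp add: enat_eq_numeral split: if_splits)

lemma coxeter_exponent_G2pp_enat:
  assumes "i \<in> nodes" "j \<in> nodes" "i \<noteq> j" "coxeter_exponent cartan_G2pp i j = enat m"
  shows "m = (if {i, j} \<in> {{-1, 0}, {0, 1}} then 3 else if {i, j} = {1, 2} then 6 else 2)"
  using assms(4) unfolding coxeter_exponent_G2pp[OF assms(1-3)]
  by (auto simp: enat_eq_numeral doubleton_eq_iff split: if_splits)

lemma refl_mat_braid:
  assumes "i \<in> nodes" "j \<in> nodes" "i \<noteq> j" "coxeter_exponent cartan_A2pp i j = enat m"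
  shows "((**) (refl_mat i ** cnj_mat (refl_mat j)) ^^ m) (mat 1) \<in> {mat 1, - mat 1}"
  using assms(1-3)
  unfolding nodes_def coxeter_exponent_A2pp_enat[OF assms]
  by (elim insertE emptyE; hypsubst;
      simp add: refl_mat_def mat_1 doubleton_eq_iff numeral_eq_Suc algebra_simps)

lemma anti_herm_root: "i \<in> nodes \<Longrightarrow> anti_herm (refl_mat i) (root i) = - root i"
  unfolding nodes_def
  by (elim insertE emptyE; hypsubst; simp add: refl_mat_def root_def anti_herm_def herm_def algebra_simps)

lemma anti_herm_root_other:
  assumes "i \<in> nodes" "j \<in> nodes" "i \<noteq> j"
  shows "anti_herm (refl_mat i) (root j) =
    (if {i, j} \<in> {{-1, 0}, {0, 1}, {0, 2}, {1, 2}} then root i + root j else root j)"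
  using assms unfolding nodes_def
  by (elim insertE emptyE; hypsubst;
      simp add: refl_mat_def root_def anti_herm_def herm_def doubleton_eq_iff algebra_simps)

lemma height_add: "height (X + Y) = height X + height Y"
  by (simp add: height_def)

lemma height_root: "i \<in> nodes \<Longrightarrow> height (root i) = 1"
  unfolding nodes_def
  by (elim insertE emptyE; hypsubst; simp add: root_def height_def omega_eq)

text \<open>
The plane \<open>Im z = 0\<close> bisects the dihedral angle \<open>\<pi>/3\<close> between walls 1 and 2, and cuts the simplex of
\<open>A\<^sub>2\<^sup>+\<^sup>+\<close> into two copies of that of \<open>G\<^sub>2\<^sup>+\<^sup>+\<close>; the reflection in it is entrywise conjugation.
\<close>

definition g2_mat :: "int \<Rightarrow> complex ^ 2 ^ 2" where
  "g2_mat i = (if i = 2 then mat 1 else refl_mat i)"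

lemma cnj_mat_mat_1: "cnj_mat (mat 1) = mat 1"
  by (simp add: mat_1)

lemma g2_mat_square: "i \<in> nodes \<Longrightarrow> g2_mat i ** cnj_mat (g2_mat i) \<in> {mat 1, - mat 1}"
  using refl_mat_square[of i] by (simp add: g2_mat_def cnj_mat_mat_1)

lemma g2_mat_braid:
  assumes "i \<in> nodes" "j \<in> nodes" "i \<noteq> j" "coxeter_exponent cartan_G2pp i j = enat m"
  shows "((**) (g2_mat i ** cnj_mat (g2_mat j)) ^^ m) (mat 1) \<in> {mat 1, - mat 1}"
  using assms(1-3)
  unfolding nodes_def coxeter_exponent_G2pp_enat[OF assms]
  by (elim insertE emptyE; hypsubst;
      simp add: g2_mat_def refl_mat_def mat_1 doubleton_eq_iff numeral_eq_Suc algebra_simps)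

section \<open>The even Weyl group of type A2++ as a Bianchi group\<close>

abbreviation "WA \<equiv> weyl_group nodes cartan_A2pp"
abbreviation "WG \<equiv> weyl_group nodes cartan_G2pp"
abbreviation "s \<equiv> weyl_gen nodes cartan_A2pp"
abbreviation "t \<equiv> weyl_gen nodes cartan_G2pp"

lemma (in group) commute_of_square:
  assumes "a \<in> carrier G" "b \<in> carrier G" "a \<otimes> a = \<one>" "b \<otimes> b = \<one>" "(a \<otimes> b) [^] (2::nat) = \<one>"
  shows "a \<otimes> b = b \<otimes> a"
proof -
  have "inv (a \<otimes> b) = a \<otimes> b"
    using assms by (intro inv_equality) (simp_all add: numeral_2_eq_2)
  moreover have "inv a = a" "inv b = b"
    using assms by (simp_all add: inv_equality)
  ultimately show ?thesis
    using assms by (simp add: inv_mult_group)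
qed

lemma (in group) braid_of_cube:
  assumes a: "a \<in> carrier G" and b: "b \<in> carrier G" and sq: "a \<otimes> a = \<one>" "b \<otimes> b = \<one>"
    and cube: "(a \<otimes> b) [^] (3::nat) = \<one>"
  shows "a \<otimes> (b \<otimes> a) = b \<otimes> (a \<otimes> b)"
proof -
  have "inv a = a" "inv b = b"
    using assms by (simp_all add: inv_equality)
  then have inv: "inv (b \<otimes> (a \<otimes> b)) = b \<otimes> (a \<otimes> b)"
    using a b by (simp add: inv_mult_group m_assoc)
  have "(a \<otimes> (b \<otimes> a)) \<otimes> (b \<otimes> (a \<otimes> b)) = \<one>"
    using cube a b by (simp add: numeral_3_eq_3 m_assoc)
  then have "inv (b \<otimes> (a \<otimes> b)) = a \<otimes> (b \<otimes> a)"
    using a b by (simp add: inv_equality)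
  with inv show ?thesis by simp
qed

lemma (in group) pow_eq_one_swap:
  assumes "a \<in> carrier G" "b \<in> carrier G" "a \<otimes> a = \<one>" "b \<otimes> b = \<one>" "(a \<otimes> b) [^] (m::nat) = \<one>"
  shows "(b \<otimes> a) [^] m = \<one>"
proof -
  have "inv a = a" "inv b = b"
    using assms by (simp_all add: inv_equality)
  then have "b \<otimes> a = inv (a \<otimes> b)"
    using assms by (simp add: inv_mult_group)
  then show ?thesis
    using assms by (simp add: nat_pow_inv)
qed

lemma nodes_simps: "- 1 \<in> nodes" "0 \<in> nodes" "1 \<in> nodes" "2 \<in> nodes"
  by (simp_all add: nodes_def)

lemma nodes_cases: "i \<in> nodes \<Longrightarrow> i = - 1 \<or> i = 0 \<or> i = 1 \<or> i = 2"
  by (simp add: nodes_def)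

lemma weyl_homs_agree:
  assumes "group H" "F \<in> hom (weyl_group I A) H" "F' \<in> hom (weyl_group I A) H"
    and gens: "\<And>i. i \<in> I \<Longrightarrow> F (weyl_gen I A i) = F' (weyl_gen I A i)"
    and x: "x \<in> carrier (weyl_group I A)"
  shows "F x = F' x"
proof -
  interpret F: group_hom "weyl_group I A" H F
    using assms group_weyl_group by (simp add: group_hom_def group_hom_axioms_def)
  interpret F': group_hom "weyl_group I A" H F'
    using assms group_weyl_group by (simp add: group_hom_def group_hom_axioms_def)
  obtain w where w: "w \<in> lists I" "x = gprod (weyl_group I A) (map (weyl_gen I A) w)"
    using weyl_group_generated[OF x] by blast
  have "map (F \<circ> weyl_gen I A) w = map (F' \<circ> weyl_gen I A) w"
    using w(1) gens by auto
  then show ?thesis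
    unfolding w(2) using weyl_gens_closed[OF w(1), of A] by (simp only: F.hom_gprod F'.hom_gprod map_map)
qed

lemma iso_restrict:
  assumes "f \<in> hom G H" "C \<subseteq> carrier G" "inj_on f C"
  shows "f \<in> iso (G\<lparr>carrier := C\<rparr>) (H\<lparr>carrier := f ` C\<rparr>)"
  using assms by (auto simp: iso_def hom_def bij_betw_def)

lemma even_weyl_group_restrict:
  "even_weyl_group I A = (weyl_group I A)\<lparr>carrier := carrier (even_weyl_group I A)\<rparr>"
  by (simp add: even_weyl_group_eq)

text \<open>
Tits' argument applies to the action by reflections of hyperbolic space, with the simple roots
\<open>root\<close> and the functional \<open>height\<close>.
\<close>

lemma A2pp_action:
  obtains \<Phi> where "\<Phi> \<in> hom WA add_aut" "\<And>i. i \<in> nodes \<Longrightarrow> \<Phi> (s i) = anti_herm (refl_mat i)"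
    "inj_on \<Phi> (carrier WA)"
proof -
  obtain \<Phi> where \<Phi>: "\<Phi> \<in> hom WA add_aut" "\<And>i. i \<in> nodes \<Longrightarrow> \<Phi> (s i) = anti_herm (refl_mat i)"
    using weyl_group_anti_herm_action[of nodes refl_mat cartan_A2pp] refl_mat_square refl_mat_braid by blast
  interpret W: group WA by (rule group_weyl_group)
  interpret \<Phi>: group_hom WA add_aut \<Phi>
    using \<Phi> W.is_group group_add_aut by (simp add: group_hom_def group_hom_axioms_def)
  note s = weyl_gen_closed[of _ nodes cartan_A2pp] and sq = weyl_gen_square[of _ nodes cartan_A2pp]
  have "x = \<one>\<^bsub>WA\<^esub>" if x: "x \<in> carrier WA" "\<Phi> x = id" for x
  proof (rule W.simply_laced_action_faithful[where act = \<Phi> and \<alpha> = root and f = height])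
    fix i j assume ij: "i \<in> nodes" "j \<in> nodes" "i \<noteq> j"
    note exp = weyl_gen_braid[OF ij, of cartan_A2pp, unfolded coxeter_exponent_A2pp[OF ij]]
    show "s i \<otimes>\<^bsub>WA\<^esub> s j = s j \<otimes>\<^bsub>WA\<^esub> s i \<and> \<Phi> (s i) (root j) = root j \<or>
      s i \<otimes>\<^bsub>WA\<^esub> (s j \<otimes>\<^bsub>WA\<^esub> s i) = s j \<otimes>\<^bsub>WA\<^esub> (s i \<otimes>\<^bsub>WA\<^esub> s j) \<and>
      \<Phi> (s i) (root j) = root i + root j \<and> \<Phi> (s j) (root i) = root i + root j"
    proof (cases "{i, j} \<in> {{-1, 0}, {0, 1}, {0, 2}, {1, 2}}")
      case True
      then have "{j, i} \<in> {{-1, 0}, {0, 1}, {0, 2}, {1, 2}}" by (simp only: insert_commute)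
      with True show ?thesis
        using W.braid_of_cube[OF s[OF ij(1)] s[OF ij(2)] sq[OF ij(1)] sq[OF ij(2)]] exp[of 3]
          anti_herm_root_other[OF ij] anti_herm_root_other[OF ij(2,1)] ij
        by (simp add: \<Phi>(2) enat_eq_numeral add.commute)
    next
      case False
      then show ?thesis
        using W.commute_of_square[OF s[OF ij(1)] s[OF ij(2)] sq[OF ij(1)] sq[OF ij(2)]] exp[of 2]
          anti_herm_root_other[OF ij] ij
        by (simp add: \<Phi>(2) enat_eq_numeral)
    qed
  next
    show "\<exists>w\<in>lists nodes. x = gprod WA (map s w)" if "x \<in> carrier WA" for x
      using weyl_group_generated[OF that] by blast
    show "\<Phi> (x \<otimes>\<^bsub>WA\<^esub> y) v = \<Phi> x (\<Phi> y v)" if "x \<in> carrier WA" "y \<in> carrier WA" for x y v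
      using that by simp
  qed (use x s sq add_aut_add[OF \<Phi>.hom_closed] in \<open>simp_all add: \<Phi>(2) anti_herm_root height_add height_root\<close>)
  then have "inj_on \<Phi> (carrier WA)"
    by (simp add: \<Phi>.inj_on_one_iff)
  with \<Phi> show thesis by (rule that)
qed

lemma refl_mat_det_entries:
  assumes "i \<in> nodes"
  shows "det (refl_mat i) = - 1" "refl_mat i $ k $ l \<in> E"
proof -
  have "det (refl_mat i) = - 1 \<and> (\<forall>k l. refl_mat i $ k $ l \<in> E)"
    using assms unfolding nodes_def
    by (elim insertE emptyE; hypsubst; simp add: refl_mat_def forall_2 algebra_simps)
  then show "det (refl_mat i) = - 1" "refl_mat i $ k $ l \<in> E" by simp_all
qed

lemma E_matrix_mult: 
  fixes M :: "complex ^ 2 ^ 2"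
  assumes "\<And>k l. M $ k $ l \<in> E" "\<And>k l. N $ k $ l \<in> E" shows "(M ** N) $ k $ l \<in> E"
  using assms by (simp add: matrix_matrix_mult_def sum_2)

lemma refl_mat_pair: "i \<in> nodes \<Longrightarrow> j \<in> nodes \<Longrightarrow> refl_mat i ** cnj_mat (refl_mat j) \<in> carrier SL2_E"
  unfolding carrier_SL2_E_entries
  by (auto simp: det_mul det_cnj_mat refl_mat_det_entries intro!: E_matrix_mult) (simp add: cnj_mat_def refl_mat_det_entries)

text \<open>
Pairs of reflections are Hermitian actions of matrices in \<open>SL\<^sub>2(E)\<close> because both determinants
are \<open>- 1\<close>. Conversely the products of two reflections yield the generators that Euclid's algorithm
needs: rotations by \<open>\<omega>\<close>, the inversion \<open>z \<mapsto> - 1 / z\<close> and the translation by 1, from which conjugation by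
rotations makes all translations.
\<close>

lemma even_image:
  assumes \<Phi>: "\<Phi> \<in> hom WA add_aut" "\<And>i. i \<in> nodes \<Longrightarrow> \<Phi> (s i) = anti_herm (refl_mat i)"
  shows "\<Phi> ` carrier even_weyl_A2pp = herm ` carrier SL2_E"
proof
  interpret W: group WA by (rule group_weyl_group)
  interpret SL: group SL2_E by (rule group_SL2_E)
  interpret \<Phi>: group_hom WA add_aut \<Phi>
    using \<Phi> W.is_group group_add_aut by (simp add: group_hom_def group_hom_axioms_def)
  interpret even: subgroup "carrier even_weyl_A2pp" WA by (rule subgroup_even_weyl)
  note s = weyl_gen_closed[of _ nodes cartan_A2pp]
  have sub: "\<Phi> (gprod WA (map s w)) \<in> herm ` carrier SL2_E"
    if "w \<in> lists nodes" "even (length w)" for w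
    using that
  proof (induction "length w" arbitrary: w rule: less_induct)
    case less
    show ?case
    proof (cases w)
      case Nil
      have "id = herm (mat 1)" "mat 1 \<in> carrier SL2_E"
        using SL.one_closed by simp_all
      then show ?thesis using Nil \<Phi>.hom_one by (metis gprod_Nil image_eqI list.map(1) one_add_aut)
    next
      case (Cons i w')
      with less.prems obtain j v where w: "w = i # j # v" by (cases w') auto
      then have ij: "i \<in> nodes" "j \<in> nodes" "v \<in> lists nodes" "even (length v)" using less.prems by auto
      have "\<Phi> (gprod WA (map s v)) \<in> herm ` carrier SL2_E"
        by (rule less.hyps) (use ij w in auto)
      then obtain M where M: "M \<in> carrier SL2_E" "\<Phi> (gprod WA (map s v)) = herm M" by blast
      have "gprod WA (map s v) \<in> carrier WA"
        using W.gprod_closed[OF weyl_gens_closed[OF ij(3)]] .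
      then have "\<Phi> (gprod WA (map s w)) = (anti_herm (refl_mat i) \<circ> anti_herm (refl_mat j)) \<circ> herm M"
        using s ij M(2) by (simp add: w \<Phi>(2) comp_assoc)
      also have "\<dots> = herm ((refl_mat i ** cnj_mat (refl_mat j)) ** M)"
        by (simp only: anti_herm_comp herm_mult)
      finally show ?thesis
        using SL.m_closed[OF refl_mat_pair[OF ij(1,2)] M(1)] by simp
    qed
  qed
  then show "\<Phi> ` carrier even_weyl_A2pp \<subseteq> herm ` carrier SL2_E"
    by (auto simp: carrier_even_weyl_group simp del: in_lists_conv_set)
  define \<Delta> where "\<Delta> = {M. herm M \<in> \<Phi> ` carrier even_weyl_A2pp}"
  have mult: "M ** N \<in> \<Delta>" if MN: "M \<in> \<Delta>" "N \<in> \<Delta>" for M N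
  proof -
    obtain x y where xy: "x \<in> carrier even_weyl_A2pp" "y \<in> carrier even_weyl_A2pp"
        "herm M = \<Phi> x" "herm N = \<Phi> y"
      using MN by (auto simp: \<Delta>_def)
    then have "herm (M ** N) = \<Phi> (x \<otimes>\<^bsub>WA\<^esub> y)"
      using even.subset by (auto simp: herm_mult)
    with xy show ?thesis unfolding \<Delta>_def by blast
  qed
  have inverse: "N \<in> \<Delta>" if MN: "M \<in> \<Delta>" "N ** M = mat 1" "M ** N = mat 1" for M N
  proof -
    obtain x where x: "x \<in> carrier even_weyl_A2pp" "herm M = \<Phi> x" 
      using MN by (auto simp: \<Delta>_def)
    have "herm N \<circ> \<Phi> x = id"
      unfolding x(2)[symmetric] using MN(2) by (simp flip: herm_mult)
    then have "inv\<^bsub>add_aut\<^esub> \<Phi> x = herm N"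
      using x even.subset herm_in_add_aut[OF MN(2,3)] by (intro \<Phi>.H.inv_equality) auto
    then have "herm N = \<Phi> (inv\<^bsub>WA\<^esub> x)"
      using x even.subset by auto
    with x show ?thesis unfolding \<Delta>_def by blast
  qed
  have pair: "refl_mat i ** cnj_mat (refl_mat j) \<in> \<Delta>" if "i \<in> nodes" "j \<in> nodes" for i j
  proof -
    have "herm (refl_mat i ** cnj_mat (refl_mat j)) = \<Phi> (gprod WA (map s [i, j]))"
      using that s by (simp add: \<Phi>(2) anti_herm_comp)
    moreover have "[i, j] \<in> lists nodes" "even (length [i, j])" using that by auto
    ultimately show ?thesis unfolding \<Delta>_def carrier_even_weyl_group by blast
  qed
  have neg: "- M \<in> \<Delta>" if "M \<in> \<Delta>" for M using that by (simp add: \<Delta>_def)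
  have D': "mat2 (- 1 - \<omega>) 0 0 \<omega> \<in> \<Delta>"
    using pair[of 1 2] by (simp add: nodes_simps refl_mat_def algebra_simps)
  have D: "mat2 \<omega> 0 0 (- 1 - \<omega>) \<in> \<Delta>"
    using mult[OF D' D'] by (simp add: algebra_simps)
  have S: "mat2 0 (- 1) 1 0 \<in> \<Delta>"
    using mult[OF D' neg[OF pair[of "-1" 1]]] by (simp add: nodes_simps refl_mat_def algebra_simps)
  have T1: "mat2 1 1 0 1 \<in> \<Delta>"
    using mult[OF pair[of 0 1] D] by (simp add: nodes_simps refl_mat_def algebra_simps)
  have T_minus: "mat2 1 (- q) 0 1 \<in> \<Delta>" if "mat2 1 q 0 1 \<in> \<Delta>" for q
    using inverse[OF that] by (simp add: mat_1)
  have T_add: "mat2 1 (p + q) 0 1 \<in> \<Delta>" if "mat2 1 p 0 1 \<in> \<Delta>" "mat2 1 q 0 1 \<in> \<Delta>" for p q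
    using mult[OF that] by (simp add: add.commute)
  have T_omega: "mat2 1 (\<omega> * q) 0 1 \<in> \<Delta>" if "mat2 1 q 0 1 \<in> \<Delta>" for q
  proof -
    have "mat2 1 (- 1 * q - \<omega> * q) 0 1 \<in> \<Delta>"
      using mult[OF mult[OF D that] D'] by (simp add: algebra_simps)
    from T_add[OF T_minus[OF this] T_minus[OF that]] show ?thesis by simp
  qed
  have T_int: "mat2 1 (of_int n) 0 1 \<in> \<Delta>" for n
  proof (induction n rule: int_induct[where k = 0])
    case base
    show ?case using T_add[OF T1 T_minus[OF T1]] by simp
  next
    case (step1 i)
    show ?case using T_add[OF step1(2) T1] by simp
  next
    case (step2 i)
    show ?case using T_add[OF step2(2) T_minus[OF T1]] by simp
  qed
  have T: "mat2 1 q 0 1 \<in> \<Delta>" if "q \<in> E" for q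
    using that T_add[OF T_int T_omega[OF T_int]] by (auto simp: E_iff mult.commute)
  show "herm ` carrier SL2_E \<subseteq> \<Phi> ` carrier even_weyl_A2pp"
    using SL2_E_generators[of \<Delta>, OF mult D S T] by (auto simp: \<Delta>_def)
qed

text \<open>
Both groups are identified with the same group of transformations of two by two matrices:
the even Weyl group by faithfulness, \<open>PSL\<^sub>2(E)\<close> by the first isomorphism theorem.
\<close>

theorem even_weyl_A2pp_iso_PSL2_E: "even_weyl_A2pp \<cong> PSL2_E"
proof -
  obtain \<Phi> where \<Phi>: "\<Phi> \<in> hom WA add_aut" "\<And>i. i \<in> nodes \<Longrightarrow> \<Phi> (s i) = anti_herm (refl_mat i)"
    and inj: "inj_on \<Phi> (carrier WA)"
    using A2pp_action by blast
  let ?\<Gamma> = "add_aut\<lparr>carrier := herm ` carrier SL2_E\<rparr>"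
  have even: "carrier even_weyl_A2pp \<subseteq> carrier WA"
    using subgroup_even_weyl by (rule subgroup.subset)
  have "\<Phi> \<in> iso even_weyl_A2pp ?\<Gamma>"
    using iso_restrict[OF \<Phi>(1) even inj_on_subset[OF inj even]]
    by (simp add: even_image[OF \<Phi>] flip: even_weyl_group_restrict)
  then have iso1: "even_weyl_A2pp \<cong> ?\<Gamma>"
    by (rule is_isoI)
  interpret W: group WA by (rule group_weyl_group)
  interpret \<Phi>: group_hom WA add_aut \<Phi>
    using \<Phi> W.is_group group_add_aut by (simp add: group_hom_def group_hom_axioms_def)
  have "subgroup (herm ` carrier SL2_E) add_aut"
    using \<Phi>.subgroup_img_is_subgroup[OF subgroup_even_weyl] by (simp add: even_image[OF \<Phi>])
  then have "group ?\<Gamma>"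
    using group_add_aut by (rule subgroup.subgroup_is_group)
  then interpret herm: group_hom SL2_E ?\<Gamma> herm
    using group_SL2_E by (simp add: group_hom_def group_hom_axioms_def hom_def herm_mult)
  have "mat 1 \<in> carrier SL2_E" using herm.G.one_closed by simp
  moreover from this have "- mat 1 \<in> carrier SL2_E"
    by (simp add: SL2_E_def forall_2 mat_1)
  moreover have "det M = 1" if "M \<in> carrier SL2_E" for M
    using that by (simp add: SL2_E_def)
  ultimately have kernel: "kernel SL2_E ?\<Gamma> herm = {mat 1, - mat 1}"
    using herm_eq_id by (auto simp: kernel_def)
  have "PSL2_E \<cong> ?\<Gamma>"
    unfolding PSL2_E_def kernel[symmetric] by (rule herm.FactGroup_iso) simp
  moreover have "group PSL2_E"
    unfolding PSL2_E_def kernel[symmetric] by (rule normal.factorgroup_is_group[OF herm.normal_kernel])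
  ultimately have "?\<Gamma> \<cong> PSL2_E"
    by (simp add: group.iso_sym)
  with iso1 show ?thesis by (rule iso_trans)
qed

section \<open>The long root subgroup of the Weyl group of type G2++\<close>

definition sign_group :: "int monoid" where
  "sign_group = \<lparr>carrier = {1, - 1}, mult = (*), one = 1\<rparr>"

lemma group_sign_group: "group sign_group"
  by (rule groupI) (auto simp: sign_group_def)

lemma sign_group_pow: "x [^]\<^bsub>sign_group\<^esub> (m::nat) = x ^ m"
  by (induction m) (simp_all add: sign_group_def nat_pow_def mult.commute)

text \<open>
Every relator of \<open>G\<^sub>2\<^sup>+\<^sup>+\<close> contains the generator of the node 2 an even number of times. The
resulting character separates the reflections in short roots from those in long roots.
\<close>

lemma G2pp_sign_character:
  obtains \<sigma> where "\<sigma> \<in> hom WG sign_group" "\<And>i. i \<in> nodes \<Longrightarrow> \<sigma> (t i) = (if i = 2 then - 1 else 1)"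
proof (rule weyl_group_universal[of sign_group nodes "\<lambda>i. if i = 2 then - 1 else 1" cartan_G2pp])
  fix i j m assume ij: "i \<in> nodes" "j \<in> nodes" "i \<noteq> j" and m: "coxeter_exponent cartan_G2pp i j = enat m"
  from coxeter_exponent_G2pp_enat[OF ij m] show "((if i = 2 then - 1 else 1) \<otimes>\<^bsub>sign_group\<^esub> (if j = 2 then - 1 else 1)) [^]\<^bsub>sign_group\<^esub> m
      = \<one>\<^bsub>sign_group\<^esub>"
    unfolding sign_group_pow using ij
    by (auto simp: sign_group_def doubleton_eq_iff)
qed (use group_sign_group that in \<open>auto simp: sign_group_def\<close>)

text \<open>
The short reflection at the node 2 maps the long simple root at the node 1 to another long root.
Together with the long simple roots it forms a simple system of type \<open>A\<^sub>2\<^sup>+\<^sup>+\<close>.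
\<close>

definition long_refl :: "int \<Rightarrow> int word set" where
  "long_refl i = (if i = 2 then t 2 \<otimes>\<^bsub>WG\<^esub> (t 1 \<otimes>\<^bsub>WG\<^esub> t 2) else t i)"

abbreviation "r \<equiv> long_refl"

interpretation WG: group WG by (rule group_weyl_group)

lemma t_closed [simp]: "i \<in> nodes \<Longrightarrow> t i \<in> carrier WG"
  by (rule weyl_gen_closed)

lemma t_square [simp]: "i \<in> nodes \<Longrightarrow> t i \<otimes>\<^bsub>WG\<^esub> t i = \<one>\<^bsub>WG\<^esub>"
  by (rule weyl_gen_square)

lemma t_square_left [simp]:
  "i \<in> nodes \<Longrightarrow> x \<in> carrier WG \<Longrightarrow> t i \<otimes>\<^bsub>WG\<^esub> (t i \<otimes>\<^bsub>WG\<^esub> x) = x"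
  by (simp flip: WG.m_assoc)

lemma t_pow:
  assumes "i \<in> nodes" "j \<in> nodes" "i \<noteq> j"
  shows "(t i \<otimes>\<^bsub>WG\<^esub> t j) [^]\<^bsub>WG\<^esub>
    (if {i, j} \<in> {{-1, 0}, {0, 1}} then 3 else if {i, j} = {1, 2} then 6 else 2::nat) = \<one>\<^bsub>WG\<^esub>"
  by (rule weyl_gen_braid[OF assms])
    (simp add: coxeter_exponent_G2pp[OF assms] numeral_eq_enat)

lemma t_commute:
  assumes "i \<in> {- 1, 0}"
  shows "t i \<otimes>\<^bsub>WG\<^esub> t 2 = t 2 \<otimes>\<^bsub>WG\<^esub> t i"
  by (rule WG.commute_of_square)
    (use assms t_pow[of i 2] in \<open>auto simp: nodes_simps doubleton_eq_iff\<close>)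

lemma r_closed [simp]: "i \<in> nodes \<Longrightarrow> r i \<in> carrier WG"
  by (simp add: long_refl_def nodes_simps)

lemma r_square [simp]: "i \<in> nodes \<Longrightarrow> r i \<otimes>\<^bsub>WG\<^esub> r i = \<one>\<^bsub>WG\<^esub>"
  by (simp add: long_refl_def nodes_simps WG.m_assoc)

text \<open>
Conjugation by the short reflection \<open>t 2\<close> induces this automorphism of the diagram of \<open>A\<^sub>2\<^sup>+\<^sup>+\<close>.
\<close>

definition swap12 :: "int \<Rightarrow> int" where
  "swap12 i = (if i = 1 then 2 else if i = 2 then 1 else i)"

lemma swap12_nodes: "i \<in> nodes \<Longrightarrow> swap12 i \<in> nodes"
  by (auto simp: nodes_def swap12_def)

lemma t2_r:
  assumes "i \<in> nodes"
  shows "t 2 \<otimes>\<^bsub>WG\<^esub> r i = r (swap12 i) \<otimes>\<^bsub>WG\<^esub> t 2"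
  using nodes_cases[OF assms] t_commute[of i]
  by (auto simp: long_refl_def swap12_def nodes_simps WG.m_assoc)

text \<open>
As \<open>t 2\<close> commutes with \<open>t i\<close>, the product is the conjugate of \<open>t i \<otimes> t 1\<close> by \<open>t 2\<close>.
\<close>

lemma r_r2_pow:
  assumes "i \<in> {- 1, 0}"
  shows "(r i \<otimes>\<^bsub>WG\<^esub> r 2) [^]\<^bsub>WG\<^esub> (if i = 0 then 3 else 2::nat) = \<one>\<^bsub>WG\<^esub>"
proof -
  have i: "i \<in> nodes" "i \<noteq> 1" "i \<noteq> 2" using assms by (auto simp: nodes_def)
  define y where "y = t i \<otimes>\<^bsub>WG\<^esub> t 1"
  have y: "y \<in> carrier WG" using i by (simp add: y_def nodes_simps)
  have "t i \<otimes>\<^bsub>WG\<^esub> (t 2 \<otimes>\<^bsub>WG\<^esub> z) = t 2 \<otimes>\<^bsub>WG\<^esub> (t i \<otimes>\<^bsub>WG\<^esub> z)" if "z \<in> carrier WG" for z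
    using t_commute[OF assms] that i by (simp add: nodes_simps flip: WG.m_assoc)
  then have "r i \<otimes>\<^bsub>WG\<^esub> r 2 = t 2 \<otimes>\<^bsub>WG\<^esub> (y \<otimes>\<^bsub>WG\<^esub> t 2)"
    using i by (simp add: long_refl_def y_def nodes_simps WG.m_assoc)
  moreover have "(t 2 \<otimes>\<^bsub>WG\<^esub> (y \<otimes>\<^bsub>WG\<^esub> t 2)) [^]\<^bsub>WG\<^esub> m = t 2 \<otimes>\<^bsub>WG\<^esub> (y [^]\<^bsub>WG\<^esub> m \<otimes>\<^bsub>WG\<^esub> t 2)" for m :: nat
    using y by (induction m) (simp_all add: nodes_simps WG.m_assoc)
  moreover have "y [^]\<^bsub>WG\<^esub> (if i = 0 then 3 else 2::nat) = \<one>\<^bsub>WG\<^esub>"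
  proof (cases "i = 0")
    case True
    then show ?thesis using t_pow[of 0 1] by (simp add: y_def nodes_simps)
  next
    case False
    then have "i = - 1" using assms by simp
    then show ?thesis using t_pow[of "- 1" 1] by (simp add: y_def nodes_simps doubleton_eq_iff)
  qed
  ultimately show ?thesis by (simp add: nodes_simps)
qed

lemma r_pow:
  assumes "i \<in> nodes" "j \<in> nodes" "i \<noteq> j"
  shows "(r i \<otimes>\<^bsub>WG\<^esub> r j) [^]\<^bsub>WG\<^esub>
    (if {i, j} \<in> {{-1, 0}, {0, 1}, {0, 2}, {1, 2}} then 3 else 2::nat) = \<one>\<^bsub>WG\<^esub>"
    (is "?P i j")
proof -
  \<comment> \<open>The rotation of order 6 about the common edge of walls 1 and 2 squares to one of order 3.\<close>
  have r12: "?P 1 2"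
  proof -
    have "r 1 \<otimes>\<^bsub>WG\<^esub> r 2 = (t 1 \<otimes>\<^bsub>WG\<^esub> t 2) [^]\<^bsub>WG\<^esub> (2::nat)"
      by (simp add: long_refl_def numeral_2_eq_2 nodes_simps WG.m_assoc)
    then have "(r 1 \<otimes>\<^bsub>WG\<^esub> r 2) [^]\<^bsub>WG\<^esub> (3::nat) = (t 1 \<otimes>\<^bsub>WG\<^esub> t 2) [^]\<^bsub>WG\<^esub> (6::nat)"
      by (simp add: WG.nat_pow_pow nodes_simps)
    then show ?thesis
      using t_pow[of 1 2] by (simp add: nodes_simps doubleton_eq_iff)
  qed
  have to2: "?P i 2" if "i \<in> nodes" "i \<noteq> 2" for i
  proof -
    have "i = - 1 \<or> i = 0 \<or> i = 1"
      using nodes_cases[OF that(1)] that(2) by blast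
    then consider "i = - 1" | "i = 0" | "i = 1" by blast
    then show ?thesis
    proof cases
      case 1
      show ?thesis unfolding 1 using r_r2_pow[of "- 1"] by (simp add: doubleton_eq_iff)
    next
      case 2
      show ?thesis unfolding 2 using r_r2_pow[of 0] by simp
    next
      case 3
      show ?thesis unfolding 3 by (rule r12)
    qed
  qed
  consider "j = 2" | "i = 2" | "i \<noteq> 2" "j \<noteq> 2" by blast
  then show ?thesis
  proof cases
    case 1
    show ?thesis
      unfolding 1 by (rule to2) (use assms 1 in auto)
  next
    case 2
    have "?P j i"
      unfolding 2 by (rule to2) (use assms 2 in auto)
    moreover have "{i, j} = {j, i}" by blast
    ultimately show ?thesis
      using WG.pow_eq_one_swap[of "r j" "r i"] assms by simp
  next
    case 3
    then have "{i, j} \<noteq> {0, 2}" "{i, j} \<noteq> {1, 2}"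
      by (auto simp: doubleton_eq_iff)
    with 3 show ?thesis
      using t_pow[OF assms] by (simp add: long_refl_def split: if_split_asm) meson
  qed
qed

text \<open>
Injectivity is read off from the geometric actions: the simplex of \<open>A\<^sub>2\<^sup>+\<^sup>+\<close> is tiled by that of
\<open>G\<^sub>2\<^sup>+\<^sup>+\<close>, so composing with the action of \<open>W(G\<^sub>2\<^sup>+\<^sup>+)\<close> gives back the faithful action of \<open>W(A\<^sub>2\<^sup>+\<^sup>+)\<close>.
\<close>

lemma A2pp_into_G2pp:
  obtains \<phi> where "\<phi> \<in> hom WA WG" "\<And>i. i \<in> nodes \<Longrightarrow> \<phi> (s i) = r i" "inj_on \<phi> (carrier WA)"
proof -
  have "(r i \<otimes>\<^bsub>WG\<^esub> r j) [^]\<^bsub>WG\<^esub> m = \<one>\<^bsub>WG\<^esub>"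
    if "i \<in> nodes" "j \<in> nodes" "i \<noteq> j" "coxeter_exponent cartan_A2pp i j = enat m" for i j m
    using r_pow[OF that(1-3)] coxeter_exponent_A2pp_enat[OF that] by simp
  then obtain \<phi> where \<phi>: "\<phi> \<in> hom WA WG" "\<And>i. i \<in> nodes \<Longrightarrow> \<phi> (s i) = r i"
    using weyl_group_universal[of WG nodes r cartan_A2pp] group_weyl_group r_closed r_square by metis
  obtain \<Phi> where \<Phi>: "\<Phi> \<in> hom WA add_aut" "\<And>i. i \<in> nodes \<Longrightarrow> \<Phi> (s i) = anti_herm (refl_mat i)"
    "inj_on \<Phi> (carrier WA)"
    using A2pp_action by blast
  obtain \<Psi> where \<Psi>: "\<Psi> \<in> hom WG add_aut" "\<And>i. i \<in> nodes \<Longrightarrow> \<Psi> (t i) = anti_herm (g2_mat i)"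
    using weyl_group_anti_herm_action[of nodes g2_mat cartan_G2pp] g2_mat_square g2_mat_braid by blast
  interpret \<Psi>: group_hom WG add_aut \<Psi>
    using \<Psi> WG.is_group group_add_aut by (simp add: group_hom_def group_hom_axioms_def)
  have gens: "(\<Psi> \<circ> \<phi>) (s i) = \<Phi> (s i)" if "i \<in> nodes" for i
  proof (cases "i = 2")
    case True
    have "anti_herm (mat 1) = cnj_mat" by (simp add: anti_herm_def)
    moreover have "cnj_mat \<circ> (anti_herm (refl_mat 1) \<circ> cnj_mat) = herm (cnj_mat (refl_mat 1)) \<circ> (cnj_mat \<circ> cnj_mat) \<circ> cnj_mat"
      by (simp add: anti_herm_def comp_assoc cnj_mat_herm flip: comp_assoc)
    moreover have "cnj_mat (refl_mat 1) = refl_mat 2"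
      by (simp add: refl_mat_def)
    ultimately show ?thesis
      by (simp add: True \<phi>(2) \<Phi>(2) \<Psi>(2) long_refl_def nodes_simps g2_mat_def)
        (simp add: cnj_mat_involution anti_herm_def)
  next
    case False
    then show ?thesis using that
      by (simp add: \<phi>(2) \<Phi>(2) \<Psi>(2) long_refl_def g2_mat_def)
  qed
  have "(\<Psi> \<circ> \<phi>) x = \<Phi> x" if "x \<in> carrier WA" for x
    by (rule weyl_homs_agree[OF group_add_aut hom_compose[OF \<phi>(1) \<Psi>(1)] \<Phi>(1) gens that])
  with \<Phi>(3) have "inj_on (\<Psi> \<circ> \<phi>) (carrier WA)"
    by (simp cong: inj_on_cong)
  then have "inj_on \<phi> (carrier WA)"
    by (rule inj_on_imageI2)
  with \<phi> show thesis by (rule that)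
qed

lemma gprod_r_closed: "w \<in> lists nodes \<Longrightarrow> gprod WG (map r w) \<in> carrier WG"
  by (rule WG.gprod_closed) auto

lemma t2_gprod_r:
  assumes "w \<in> lists nodes"
  shows "t 2 \<otimes>\<^bsub>WG\<^esub> gprod WG (map r w) = gprod WG (map r (map swap12 w)) \<otimes>\<^bsub>WG\<^esub> t 2"
  using assms
proof (induction w rule: lists.induct)
  case Nil
  then show ?case by (simp add: nodes_simps)
next
  case (Cons i w)
  have "map swap12 w \<in> lists nodes" using Cons.hyps swap12_nodes by auto
  then have cl: "gprod WG (map r w) \<in> carrier WG" "gprod WG (map r (map swap12 w)) \<in> carrier WG"
    using Cons.hyps by (simp_all add: gprod_r_closed del: in_lists_conv_set map_map)
  have "t 2 \<otimes>\<^bsub>WG\<^esub> (r i \<otimes>\<^bsub>WG\<^esub> gprod WG (map r w)) = (t 2 \<otimes>\<^bsub>WG\<^esub> r i) \<otimes>\<^bsub>WG\<^esub> gprod WG (map r w)"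
    using cl Cons.hyps by (simp add: WG.m_assoc nodes_simps)
  also have "\<dots> = r (swap12 i) \<otimes>\<^bsub>WG\<^esub> (t 2 \<otimes>\<^bsub>WG\<^esub> gprod WG (map r w))"
    unfolding t2_r[OF Cons.hyps(1)]
    using cl Cons.hyps by (simp add: WG.m_assoc nodes_simps swap12_nodes)
  also have "\<dots> = gprod WG (map r (map swap12 (i # w))) \<otimes>\<^bsub>WG\<^esub> t 2"
    unfolding Cons.IH using cl Cons.hyps by (simp add: WG.m_assoc nodes_simps swap12_nodes del: map_map)
  finally show ?case by simp
qed

text \<open>
\<open>W(G\<^sub>2\<^sup>+\<^sup>+)\<close> is the product of the long root subgroup and \<open>\<langle>t 2\<rangle>\<close>. The parity of the word in the
long reflections is recorded because membership in the even subgroup depends on it.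
\<close>

lemma G2pp_decomposition:
  assumes "w \<in> lists nodes"
  shows "\<exists>v\<in>lists nodes.
    even (length v) = even (length w) \<and> gprod WG (map t w) = gprod WG (map r v) \<or>
    even (length v) \<noteq> even (length w) \<and> gprod WG (map t w) = gprod WG (map r v) \<otimes>\<^bsub>WG\<^esub> t 2"
  using assms
proof (induction w rule: lists.induct)
  case Nil
  show ?case by (rule bexI[of _ "[]"]) auto
next
  case (Cons i w)
  then obtain v where v: "v \<in> lists nodes"
    "even (length v) = even (length w) \<and> gprod WG (map t w) = gprod WG (map r v) \<or>
     even (length v) \<noteq> even (length w) \<and> gprod WG (map t w) = gprod WG (map r v) \<otimes>\<^bsub>WG\<^esub> t 2"
    by blast
  note cl = gprod_r_closed[OF v(1)]
  show ?case
  proof (cases "i = 2")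
    case False
    then have "r i = t i" by (simp add: long_refl_def)
    then show ?thesis
      using v cl Cons.hyps by (intro bexI[of _ "i # v"]) (auto simp: WG.m_assoc nodes_simps)
  next
    case True
    let ?v = "map swap12 v"
    have v': "?v \<in> lists nodes" using v(1) swap12_nodes by auto
    note cl' = gprod_r_closed[OF v']
    have "t 2 \<otimes>\<^bsub>WG\<^esub> (gprod WG (map r v) \<otimes>\<^bsub>WG\<^esub> t 2) = gprod WG (map r ?v)"
      using t2_gprod_r[OF v(1)] cl cl' by (simp add: nodes_simps WG.m_assoc flip: WG.m_assoc del: map_map)
         (simp add: nodes_simps WG.m_assoc)
    then show ?thesis
      using v v' t2_gprod_r[OF v(1)] True by (intro bexI[of _ ?v]) (auto simp del: map_map)
  qed
qed

lemma gprod_r_as_t: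
  assumes "w \<in> lists nodes"
  shows "\<exists>v\<in>lists nodes. even (length v) = even (length w) \<and> gprod WG (map r w) = gprod WG (map t v)"
  using assms
proof (induction w rule: lists.induct)
  case Nil
  show ?case by (rule bexI[of _ "[]"]) auto
next
  case (Cons i w)
  then obtain v where v: "v \<in> lists nodes" "even (length v) = even (length w)"
      "gprod WG (map r w) = gprod WG (map t v)"
    by blast
  have cl: "gprod WG (map t v) \<in> carrier WG"
    using v(1) by (intro WG.gprod_closed) auto
  show ?case
  proof (cases "i = 2")
    case False
    then have "r i = t i" by (simp add: long_refl_def)
    then show ?thesis
      using v Cons.hyps by (intro bexI[of _ "i # v"]) auto
  next
    case True
    then have "r i = t 2 \<otimes>\<^bsub>WG\<^esub> (t 1 \<otimes>\<^bsub>WG\<^esub> t 2)" by (simp add: long_refl_def)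
    then have "gprod WG (map r (i # w)) = gprod WG (map t (2 # 1 # 2 # v))"
      using cl by (simp add: v(3) nodes_simps WG.m_assoc)
    then show ?thesis
      using v by (intro bexI[of _ "2 # 1 # 2 # v"]) (simp_all add: nodes_simps)
  qed
qed

section \<open>The semidirect decomposition\<close>

lemma is_semidirect_by_2_cong:
  assumes "is_semidirect_by_2 G A" "A \<cong> B"
  shows "is_semidirect_by_2 G B"
  using assms unfolding is_semidirect_by_2_def by (meson iso_trans)

text \<open>
The normal subgroup is the kernel of the sign character on the even subgroup, which makes normality
and index immediate. The generator \<open>t 2\<close> itself is odd, so the complement is generated by its
product with the commuting long reflection \<open>t (- 1)\<close>.
\<close>

theorem G2pp_semidirect_A2pp: "is_semidirect_by_2 even_weyl_G2pp even_weyl_A2pp"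
proof -
  let ?G = even_weyl_G2pp
  obtain \<phi> where \<phi>: "\<phi> \<in> hom WA WG" "\<And>i. i \<in> nodes \<Longrightarrow> \<phi> (s i) = r i" "inj_on \<phi> (carrier WA)"
    using A2pp_into_G2pp by blast
  obtain \<sigma> where \<sigma>: "\<sigma> \<in> hom WG sign_group" "\<And>i. i \<in> nodes \<Longrightarrow> \<sigma> (t i) = (if i = 2 then - 1 else 1)"
    using G2pp_sign_character by blast
  interpret WA: group WA by (rule group_weyl_group)
  interpret \<phi>: group_hom WA WG \<phi>
    using \<phi> WG.is_group WA.is_group by (simp add: group_hom_def group_hom_axioms_def)
  interpret \<sigma>: group_hom WG sign_group \<sigma>
    using \<sigma> WG.is_group group_sign_group by (simp add: group_hom_def group_hom_axioms_def)
  have sgn: "x \<otimes>\<^bsub>sign_group\<^esub> y = x * y" "\<one>\<^bsub>sign_group\<^esub> = 1" for x y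
    by (simp_all add: sign_group_def)
  have sub: "subgroup (carrier ?G) WG"
    by (rule subgroup_even_weyl)
  then interpret G: group ?G
    using subgroup.subgroup_is_group[OF sub WG.is_group] by (simp flip: even_weyl_group_restrict)
  have G_simps: "x \<otimes>\<^bsub>?G\<^esub> y = x \<otimes>\<^bsub>WG\<^esub> y" "\<one>\<^bsub>?G\<^esub> = \<one>\<^bsub>WG\<^esub>" for x y
    by (simp_all add: even_weyl_group_eq)
  have evenA: "carrier even_weyl_A2pp \<subseteq> carrier WA"
    by (rule subgroup.subset[OF subgroup_even_weyl])
  have G_sub: "x \<in> carrier WG" if "x \<in> carrier ?G" for x
    using subgroup.subset[OF sub] that by blast

  have phi_word: "\<phi> (gprod WA (map s v)) = gprod WG (map r v)" if v: "v \<in> lists nodes" for v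
  proof -
    have "map \<phi> (map s v) = map r v" using v \<phi>(2) by auto
    then show ?thesis using \<phi>.hom_gprod[OF weyl_gens_closed[OF v]] by (simp only:)
  qed
  have sigma_r: "\<sigma> (gprod WG (map r v)) = 1" if "v \<in> lists nodes" for v
    using that
  proof (induction v rule: lists.induct)
    case Nil
    then show ?case using \<sigma>.hom_one by (simp add: sgn)
  next
    case (Cons i v)
    have "\<sigma> (r i) = 1"
      using Cons.hyps(1) by (simp add: long_refl_def \<sigma>(2) nodes_simps sgn)
    then show ?case
      using Cons by (simp add: gprod_r_closed sgn del: in_lists_conv_set)
  qed

  define N where "N = \<phi> ` carrier even_weyl_A2pp"
  have N_iff: "x \<in> N \<longleftrightarrow> (\<exists>v\<in>lists nodes. even (length v) \<and> x = gprod WG (map r v))" for x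
  proof -
    have "x \<in> N \<longleftrightarrow> (\<exists>v\<in>lists nodes. even (length v) \<and> x = \<phi> (gprod WA (map s v)))"
      by (auto simp: N_def carrier_even_weyl_group simp del: in_lists_conv_set)
    then show ?thesis by (simp add: phi_word cong: bex_cong conj_cong del: in_lists_conv_set)
  qed
  define k where "k = t (- 1) \<otimes>\<^bsub>WG\<^esub> t 2"
  have k: "k \<in> carrier WG" by (simp add: k_def nodes_simps)
  have "k = gprod WG (map t [- 1, 2])" "[- 1, 2] \<in> lists nodes" "even (length [- 1, 2 :: int])"
    by (simp_all add: k_def nodes_simps)
  then have kG: "k \<in> carrier ?G"
    unfolding carrier_even_weyl_group by blast
  have kk: "k \<otimes>\<^bsub>WG\<^esub> k = \<one>\<^bsub>WG\<^esub>"
  proof -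
    have "k = t 2 \<otimes>\<^bsub>WG\<^esub> t (- 1)" using t_commute[of "- 1"] by (simp add: k_def)
    then have "k \<otimes>\<^bsub>WG\<^esub> k = t 2 \<otimes>\<^bsub>WG\<^esub> t (- 1) \<otimes>\<^bsub>WG\<^esub> (t (- 1) \<otimes>\<^bsub>WG\<^esub> t 2)"
      by (simp add: k_def)
    then show ?thesis by (simp add: WG.m_assoc nodes_simps)
  qed
  have sigma_k: "\<sigma> k = - 1"
    by (simp add: k_def \<sigma>(2) nodes_simps sgn)

  have decompose: "x \<in> N \<or> (\<exists>n\<in>N. x = n \<otimes>\<^bsub>WG\<^esub> k)" if "x \<in> carrier ?G" for x
  proof -
    obtain w where w: "w \<in> lists nodes" "even (length w)" "x = gprod WG (map t w)"
      using \<open>x \<in> carrier ?G\<close> unfolding carrier_even_weyl_group by blast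
    obtain v where v: "v \<in> lists nodes"
      "even (length v) \<and> x = gprod WG (map r v) \<or> odd (length v) \<and> x = gprod WG (map r v) \<otimes>\<^bsub>WG\<^esub> t 2"
      using G2pp_decomposition[OF w(1)] w(2,3) by auto
    from v(2) show ?thesis
    proof
      assume "even (length v) \<and> x = gprod WG (map r v)"
      then show ?thesis using v(1) N_iff by blast
    next
      assume odd: "odd (length v) \<and> x = gprod WG (map r v) \<otimes>\<^bsub>WG\<^esub> t 2"
      have cl: "gprod WG (map r v) \<in> carrier WG" by (rule gprod_r_closed[OF v(1)])
      \<comment> \<open>Insert \<open>t (- 1) \<otimes> t (- 1)\<close>: one factor makes the number of long reflections even, the other completes \<open>t 2\<close> to \<open>k\<close>.\<close>
      have "gprod WG (map r (v @ [- 1])) = gprod WG (map r v) \<otimes>\<^bsub>WG\<^esub> t (- 1)"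
      proof -
        have "set (map r v) \<subseteq> carrier WG" using v(1) r_closed by auto
        moreover have "r (- 1) = t (- 1)" by (simp add: long_refl_def)
        ultimately show ?thesis
          using WG.gprod_append[of "map r v" "[t (- 1)]"] by (simp add: nodes_simps)
      qed
      then have "x = gprod WG (map r (v @ [- 1])) \<otimes>\<^bsub>WG\<^esub> k"
        using odd cl by (simp add: k_def WG.m_assoc nodes_simps)
      moreover have "gprod WG (map r (v @ [- 1])) \<in> N"
        unfolding N_iff using v(1) odd by (intro bexI[of _ "v @ [- 1]"]) (auto simp: nodes_simps)
      ultimately show ?thesis by blast
    qed
  qed
  have sigma_N: "\<sigma> n = 1" if "n \<in> N" for n
    using that sigma_r unfolding N_iff by blast
  have N_sub: "n \<in> carrier ?G" if n: "n \<in> N" for n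
  proof -
    obtain v where v: "v \<in> lists nodes" "even (length v)" "n = gprod WG (map r v)"
      using n unfolding N_iff by blast
    obtain w where "w \<in> lists nodes" "even (length w)" "n = gprod WG (map t w)"
      using gprod_r_as_t[OF v(1)] v(2,3) by auto
    then show ?thesis unfolding carrier_even_weyl_group by blast
  qed

  interpret \<sigma>': group_hom ?G sign_group \<sigma>
    using G.is_group group_sign_group \<sigma>(1) G_sub
    by (auto simp: group_hom_def group_hom_axioms_def hom_def G_simps)
  have kernel: "kernel ?G sign_group \<sigma> = N"
  proof (intro Set.set_eqI iffI)
    fix x assume "x \<in> kernel ?G sign_group \<sigma>"
    then have x: "x \<in> carrier ?G" "\<sigma> x = 1" by (auto simp: kernel_def sgn)
    then show "x \<in> N"
      using decompose[OF x(1)] sigma_N sigma_k k G_sub N_sub by (auto simp: sgn)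
  next
    fix x assume "x \<in> N"
    then show "x \<in> kernel ?G sign_group \<sigma>"
      using sigma_N N_sub by (auto simp: kernel_def sgn)
  qed
  have normal: "N \<lhd> ?G"
    using \<sigma>'.normal_kernel by (simp add: kernel)
  have "\<sigma> ` carrier ?G = carrier sign_group"
  proof
    show "\<sigma> ` carrier ?G \<subseteq> carrier sign_group" by auto
    have "\<sigma> \<one>\<^bsub>WG\<^esub> = 1" using \<sigma>.hom_one by (simp add: sgn)
    moreover have "\<one>\<^bsub>WG\<^esub> \<in> carrier ?G" using G.one_closed by (simp add: G_simps)
    ultimately show "carrier sign_group \<subseteq> \<sigma> ` carrier ?G"
      using sigma_k kG by (auto simp: sign_group_def intro: rev_image_eqI)
  qed
  then have "card (carrier (?G Mod N)) = card (carrier sign_group)"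
    using iso_same_card[OF \<sigma>'.FactGroup_iso] by (simp add: kernel)
  then have index: "card (rcosets\<^bsub>?G\<^esub> N) = 2"
    by (simp add: FactGroup_def sign_group_def)

  define K where "K = {\<one>\<^bsub>WG\<^esub>, k}"
  have k_one: "k \<noteq> \<one>\<^bsub>WG\<^esub>" using sigma_k \<sigma>.hom_one by (auto simp: sgn)
  have one_G: "\<one>\<^bsub>WG\<^esub> \<in> carrier ?G" using G.one_closed by (simp add: G_simps)
  have inv_k: "inv\<^bsub>?G\<^esub> k = k" by (rule G.inv_equality) (simp_all add: G_simps kk kG)
  have K: "subgroup K ?G"
  proof (rule G.subgroupI)
    show "inv\<^bsub>?G\<^esub> a \<in> K" if "a \<in> K" for a
      using that inv_k G.inv_one by (auto simp: K_def G_simps)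
    show "a \<otimes>\<^bsub>?G\<^esub> b \<in> K" if "a \<in> K" "b \<in> K" for a b
      using that unfolding K_def G_simps by (elim insertE emptyE) (simp_all add: k kk)
  qed (use kG one_G in \<open>auto simp: K_def\<close>)
  have N_one: "\<one>\<^bsub>WG\<^esub> \<in> N"
    using kernel one_G \<sigma>.hom_one by (auto simp: kernel_def)
  have inter: "N \<inter> K = {\<one>\<^bsub>?G\<^esub>}"
    using N_one sigma_N[of k] sigma_k by (auto simp: K_def G_simps)
  have product: "N <#>\<^bsub>?G\<^esub> K = carrier ?G"
  proof
    show "N <#>\<^bsub>?G\<^esub> K \<subseteq> carrier ?G"
      using N_sub subgroup.subset[OF K] by (auto simp: set_mult_def)
    show "carrier ?G \<subseteq> N <#>\<^bsub>?G\<^esub> K"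
    proof
      fix x assume x: "x \<in> carrier ?G"
      then have "x = x \<otimes>\<^bsub>WG\<^esub> \<one>\<^bsub>WG\<^esub>" using G_sub by simp
      then show "x \<in> N <#>\<^bsub>?G\<^esub> K"
        using decompose[OF x] by (auto simp: set_mult_def K_def G_simps)
    qed
  qed

  have "\<phi> \<in> iso even_weyl_A2pp (?G\<lparr>carrier := N\<rparr>)"
    using iso_restrict[OF \<phi>(1) evenA inj_on_subset[OF \<phi>(3) evenA]]
    by (simp add: N_def even_weyl_group_eq)
  moreover have "group even_weyl_A2pp"
    using subgroup.subgroup_is_group[OF subgroup_even_weyl WA.is_group]
    by (simp flip: even_weyl_group_restrict)
  ultimately have iso: "?G\<lparr>carrier := N\<rparr> \<cong> even_weyl_A2pp"
    by (meson group.iso_sym is_isoI)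
  have "card K = 2" using k_one by (auto simp: K_def)
  with normal iso index K inter product show ?thesis
    unfolding is_semidirect_by_2_def by blast
qed

theorem proposition7:
  shows "is_semidirect_by_2 even_weyl_G2pp even_weyl_A2pp
    \<and> is_semidirect_by_2 even_weyl_G2pp PSL2_E"
  using G2pp_semidirect_A2pp is_semidirect_by_2_cong[OF _ even_weyl_A2pp_iso_PSL2_E] by blast

end
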